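(* Let $(A_N)_{N\ge2}$ be a sequence of coupling matrices such that $\max_{1\le i\le N}R_i\lesssim1$, $\lim_{N\to\infty}\lambda_1(A_N)=1$, $$\lim_{N\to\infty}\frac1N\sum_{i=1}^N(R_i-1)^2=0,\qquad\lim_{N\to\infty}\frac1N\lVert A_N\rVert_F^2=0,$$ and let $\boldsymbol\sigma$ be drawn from the Ising model $\mathbb P$ with parameters $(A_N,\beta,B)$. (i) If $(\beta,B)\in\Theta_1$, then for every $\delta>0$ $$\limsup_{N\to\infty}\frac1N\log\mathbb P(|\overline{\boldsymbol\sigma}-t|>\delta)<0.$$ The same conclusion holds for $(\beta,B)\in\Theta_3$ under the extra assumption $\limsup_{N\to\infty}\frac{\lambda_2(A_N)}{\lambda_1(A_N)}<1$. (ii) If $(\beta,B)\in\Theta_2$, then under the extra assumption $\limsup_{N\to\infty}\frac{\lambda_2(A_N)}{\lambda_1(A_N)}<1$, for every $\delta>0$ $$\limsup_{N\to\infty}\frac1N\log\mathbb P(|\overline{\boldsymbol\sigma}-M(\boldsymbol\sigma)|>\delta)<0.$$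
   Context: A coupling matrix $A_N$ is a symmetric $N\times N$ matrix with non-negative entries and zeros on the diagonal. The Ising model with parameters $(A_N,\beta,B)$, $\beta>0$, $B\in\mathbb R$, is the probability mass function on $\boldsymbol\sigma=(\sigma_1,\dots,\sigma_N)\in\{-1,1\}^N$ given by $\mathbb P(\boldsymbol\sigma)=\frac1{Z_N(\beta,B)}\exp\big(\frac\beta2\boldsymbol\sigma^\top A_N\boldsymbol\sigma+B\sum_{i=1}^N\sigma_i\big)$. Put $\overline{\boldsymbol\sigma}=\frac1N\sum_{i=1}^N\sigma_i$, $R_i=\sum_{j=1}^NA_N(i,j)$, $\lambda_1(A_N)\ge\dots\ge\lambda_N(A_N)$ the eigenvalues, $\lVert\cdot\rVert_F$ the Frobenius norm. $\max_iR_i\lesssim1$ means $\sup_N\max_{1\le i\le N}R_i<\infty$. Convention: $\log0=-\infty$. Parameter regimes: $\Theta_{11}=\{(\beta,0):0<\beta<1\}$, $\Theta_{12}=\{(\beta,B):\beta>0,B\ne0\}$, $\Theta_1=\Theta_{11}\cup\Theta_{12}$, $\Theta_2=\{(\beta,0):\beta>1\}$, $\Theta_3=\{(1,0)\}$. Define $t$: for $(\beta,B)\in\Theta_{11}\cup\Theta_3$, $t=0$; for $(\beta,B)\in\Theta_{12}$, $t$ is the unique solution of $x=\tanh(\beta x+B)$ with the same sign as $B$; for $(\beta,B)\in\Theta_2$, $t$ is the unique strictly positive solution of $x=\tanh(\beta x)$. For $(\beta,B)\in\Theta_2$, $M(\boldsymbol\sigma)=t$ if $\overline{\boldsymbol\sigma}\ge0$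 and $M(\boldsymbol\sigma)=-t$ otherwise. *)

theory Defs
  imports "HOL-Probability.Probability" "Jordan_Normal_Form.Char_Poly"
begin

unbundle no vec_syntax

text \<open>Vectors and matrices are those of \<^theory>\<open>Jordan_Normal_Form.Matrix\<close>, so that the dimension
  can vary along a sequence. The indices $1,\dots,N$ become $0,\dots,N-1$.\<close>

definition coupling_matrix :: "nat \<Rightarrow> real mat \<Rightarrow> bool" where
  "coupling_matrix N A \<longleftrightarrow>
     A \<in> carrier_mat N N \<and> transpose_mat A = A \<and>
     (\<forall>i<N. \<forall>j<N. 0 \<le> A $$ (i, j)) \<and> (\<forall>i<N. A $$ (i, i) = 0)"

definition row_sum :: "real mat \<Rightarrow> nat \<Rightarrow> real" where
  "row_sum A i = (\<Sum>j<dim_col A. A $$ (i, j))"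

definition frobenius_norm :: "real mat \<Rightarrow> real" where
  "frobenius_norm A = sqrt (\<Sum>i<dim_row A. \<Sum>j<dim_col A. (A $$ (i, j))\<^sup>2)"

text \<open>The \<open>k\<close>-th largest eigenvalue (\<open>k\<close> counted from 1), with multiplicity. The multiset of real
  roots of the characteristic polynomial has \<open>N\<close> elements when \<open>A\<close> is a symmetric
  \<open>N \<times> N\<close> matrix.\<close>

definition kth_eigenvalue :: "nat \<Rightarrow> real mat \<Rightarrow> real" where
  "kth_eigenvalue k A = rev (sorted_list_of_multiset (proots (char_poly A))) ! (k - 1)"


definition spins :: "nat \<Rightarrow> real vec set" where
  "spins N = {\<sigma> \<in> carrier_vec N. \<forall>i<N. \<sigma> $ i \<in> {-1, 1}}"

definition ising_weight :: "real mat \<Rightarrow> real \<Rightarrow> real \<Rightarrow> real vec \<Rightarrow> real" where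
  "ising_weight A \<beta> B \<sigma> =
     exp (\<beta> / 2 * scalar_prod \<sigma> (A *\<^sub>v \<sigma>) + B * (\<Sum>i<dim_vec \<sigma>. \<sigma> $ i))"

definition ising_Z :: "real mat \<Rightarrow> real \<Rightarrow> real \<Rightarrow> real" where
  "ising_Z A \<beta> B = (\<Sum>\<sigma> \<in> spins (dim_row A). ising_weight A \<beta> B \<sigma>)"

definition ising_pmf :: "real mat \<Rightarrow> real \<Rightarrow> real \<Rightarrow> real vec pmf" where
  "ising_pmf A \<beta> B = embed_pmf
     (\<lambda>\<sigma>. if \<sigma> \<in> spins (dim_row A) then ising_weight A \<beta> B \<sigma> / ising_Z A \<beta> B else 0)"

lemma finite_spins: "finite (spins N)"
proof -
  have "spins N \<subseteq> vec N ` ({..<N} \<rightarrow>\<^sub>E {-1, 1})"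
  proof
    fix \<sigma> assume s: "\<sigma> \<in> spins N"
    have "\<sigma> = vec N (restrict (\<lambda>i. \<sigma> $ i) {..<N})"
      using s by (intro eq_vecI) (auto simp: spins_def)
    moreover have "restrict (\<lambda>i. \<sigma> $ i) {..<N} \<in> {..<N} \<rightarrow>\<^sub>E {-1, 1}"
      using s by (auto simp: spins_def)
    ultimately show "\<sigma> \<in> vec N ` ({..<N} \<rightarrow>\<^sub>E {-1, 1})" by blast
  qed
  then show ?thesis by (rule finite_subset) (intro finite_imageI finite_PiE, auto)
qed

lemma ising_Z_pos: "0 < ising_Z A \<beta> B"
proof -
  have "vec (dim_row A) (\<lambda>_. 1) \<in> spins (dim_row A)" by (auto simp: spins_def)
  then show ?thesis unfolding ising_Z_def
    by (intro sum_pos) (auto simp: finite_spins ising_weight_def)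
qed

lemma pmf_ising_pmf:
  "pmf (ising_pmf A \<beta> B) \<sigma> =
     (if \<sigma> \<in> spins (dim_row A) then ising_weight A \<beta> B \<sigma> / ising_Z A \<beta> B else 0)"
  unfolding ising_pmf_def
proof (rule pmf_embed_pmf)
  let ?S = "spins (dim_row A)"
  let ?f = "\<lambda>\<sigma>. if \<sigma> \<in> ?S then ising_weight A \<beta> B \<sigma> / ising_Z A \<beta> B else 0"
  show nn: "0 \<le> ?f \<sigma>" for \<sigma>
    using ising_Z_pos[of A \<beta> B] by (auto simp: ising_weight_def)
  have "(\<integral>\<^sup>+\<sigma>. ennreal (?f \<sigma>) \<partial>count_space UNIV) = (\<Sum>\<sigma>\<in>?S. ennreal (?f \<sigma>))"
    by (rule nn_integral_count_space'[OF finite_spins]) auto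
  also have "\<dots> = ennreal (\<Sum>\<sigma>\<in>?S. ?f \<sigma>)"
    by (rule sum_ennreal) (rule nn)
  also have "(\<Sum>\<sigma>\<in>?S. ?f \<sigma>) = 1"
    using ising_Z_pos[of A \<beta> B] by (simp add: sum_divide_distrib[symmetric] ising_Z_def)
  finally show "(\<integral>\<^sup>+\<sigma>. ennreal (?f \<sigma>) \<partial>count_space UNIV) = 1" by simp
qed

definition spin_mean :: "real vec \<Rightarrow> real" where
  "spin_mean \<sigma> = (\<Sum>i<dim_vec \<sigma>. \<sigma> $ i) / real (dim_vec \<sigma>)"


definition Theta11 :: "(real \<times> real) set" where "Theta11 = {(\<beta>, 0) |\<beta>. 0 < \<beta> \<and> \<beta> < 1}"
definition Theta12 :: "(real \<times> real) set" where "Theta12 = {(\<beta>, B). 0 < \<beta> \<and> B \<noteq> 0}"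
definition Theta1 :: "(real \<times> real) set" where "Theta1 = Theta11 \<union> Theta12"
definition Theta2 :: "(real \<times> real) set" where "Theta2 = {(\<beta>, 0) |\<beta>. 1 < \<beta>}"
definition Theta3 :: "(real \<times> real) set" where "Theta3 = {(1, 0)}"

definition magnetization :: "real \<Rightarrow> real \<Rightarrow> real" where
  "magnetization \<beta> B =
     (if (\<beta>, B) \<in> Theta12 then THE x. x = tanh (\<beta> * x + B) \<and> sgn x = sgn B
      else if (\<beta>, B) \<in> Theta2 then THE x. 0 < x \<and> x = tanh (\<beta> * x)
      else 0)"

definition signed_magnetization :: "real \<Rightarrow> real \<Rightarrow> real vec \<Rightarrow> real" where
  "signed_magnetization \<beta> B \<sigma> =
     (if 0 \<le> spin_mean \<sigma> then magnetization \<beta> B else - magnetization \<beta> B)"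

text \<open>The logarithm with $\log 0 = -\infty$; it is only applied to probabilities.\<close>

definition elog :: "real \<Rightarrow> ereal" where
  "elog p = (if p \<le> 0 then -\<infinity> else ereal (ln p))"

end

theory Submission
  imports Defs "Jordan_Normal_Form.Schur_Decomposition" "HOL-Real_Asymp.Real_Asymp"
begin

text \<open>For a convex set \<open>C\<close> of magnetizations, the total weight of the configurations with mean in \<open>C\<close>
  is compared with a single mean-field energy. Among the subsets of these configurations there is one
  of almost the same log-weight whose pairwise spin covariances are small on average; on it the energy
  is, up to \<open>o(N)\<close> because the Frobenius norm is \<open>o(\<surd>N)\<close>, the quadratic form of the mean vector
  \<open>m\<close>, and the entropy is at most the sum of the entropies of the \<open>m i\<close>. Since \<open>C\<close> is
  convex, the average of \<open>m\<close> still lies in \<open>C\<close>. Conversely the product measure with mean \<open>t\<close>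
  bounds the partition function from below.

  It remains to see that \<open>m\<close> with average far from \<open>t\<close> loses a multiple of \<open>N\<close> against
  \<open>N\<close> times the maximum of the scalar free energy. As the top eigenvalue tends to \<open>1\<close>, the
  quadratic form is at most the sum of the \<open>(m i)\<^sup>2\<close>, which settles the case of a unique maximizer. For two
  maximizers \<open>\<plusminus>t\<close> the spectral gap penalizes the variance of the \<open>m i\<close>, which
  excludes mixtures of both phases.\<close>

unbundle no inner_syntax

section \<open>Spectral theorem for symmetric real matrices\<close>

text \<open>Averaging forces convex events: a mixture of configurations on both sides of
  \<open>t\<close> can have its mean anywhere in between. The deviation event is therefore covered
  by finitely many intervals, each treated alone; the union bound costs only a constant factor. With
  a pinning budget \<open>\<epsilon> * N\<close> the squared covariances sum to at most
  \<open>N / \<epsilon>\<close>, and Cauchy-Schwarz bounds the energy error by a multiple of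
  \<open>frobenius_norm A * sqrt (N / \<epsilon>)\<close>, which is o(N) for each fixed
  \<open>\<epsilon>\<close>. The matrix is seen from above through its top eigenvalue and from below
  through its average row sum. The two bounds agree to order \<open>N\<close> because both
  quantities tend to 1. The free energy is flat at its maximum, so a linear loss
  \<open>\<kappa> * \<bar>x - t\<bar>\<close> or
  \<open>\<kappa> * \<bar>x\<^sup>2 - t\<^sup>2\<bar>\<close> is available only up to a small slack;
  such losses can be summed over the coordinates and compared with the average.\<close>

lemma symmetric_mat_real_eigenvalue:
  fixes A :: "real mat"
  assumes A: "A \<in> carrier_mat n n" and sym: "transpose_mat A = A" and n: "n \<noteq> 0"
  shows "\<exists>e. eigenvalue A e"
proof -
  define C where "C = map_mat complex_of_real A"
  have C: "C \<in> carrier_mat n n" using A by (simp add: C_def)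
  have Csym: "C $$ (i, j) = C $$ (j, i)" if "i < n" "j < n" for i j
  proof -
    have "transpose_mat A $$ (i, j) = A $$ (j, i)" using that A by simp
    then show ?thesis using that A sym by (simp add: C_def)
  qed
  have Creal: "cnj (C $$ (i, j)) = C $$ (i, j)" if "i < n" "j < n" for i j
    using that A by (simp add: C_def)
  obtain as where as: "char_poly C = (\<Prod>a\<leftarrow>as. [:- a, 1:])" "length as = n"
    using char_poly_factorized[OF C] by blast
  obtain a as' where as': "as = a # as'" using as(2) n by (metis length_0_conv list.exhaust)
  then have "poly (char_poly C) a = 0" unfolding as(1) as' by simp
  then obtain v where v: "v \<in> carrier_vec n" "v \<noteq> 0\<^sub>v n" "C *\<^sub>v v = a \<cdot>\<^sub>v v"
    using eigenvalue_root_char_poly[OF C] C unfolding eigenvalue_def eigenvector_def by auto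
  \<comment> \<open>\<open>S\<close> is the Hermitian form of \<open>C\<close> at the complex
    eigenvector \<open>v\<close>, and \<open>V\<close> its squared norm. \<open>S\<close> is real
    because \<open>C\<close> is real symmetric, and \<open>S = a * V\<close> with \<open>V\<close>
    real and nonzero, so \<open>a\<close> is real.\<close>
  define S where "S = (\<Sum>i<n. (C *\<^sub>v v) $ i * cnj (v $ i))"
  define V where "V = (\<Sum>i<n. v $ i * cnj (v $ i))"
  have "S = (\<Sum>i<n. \<Sum>j<n. C $$ (i, j) * v $ j * cnj (v $ i))"
    unfolding S_def using C v(1)
    by (intro sum.cong) (auto simp: scalar_prod_def sum_distrib_right atLeast0LessThan)
  moreover have "cnj \<dots> = (\<Sum>i<n. \<Sum>j<n. C $$ (i, j) * cnj (v $ j) * v $ i)"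
    by (auto simp: Creal)
  moreover have "\<dots> = (\<Sum>j<n. \<Sum>i<n. C $$ (i, j) * cnj (v $ j) * v $ i)"
    by (rule sum.swap)
  moreover have "\<dots> = (\<Sum>i<n. \<Sum>j<n. C $$ (i, j) * v $ j * cnj (v $ i))"
    by (intro sum.cong) (auto simp: Csym mult_ac)
  ultimately have "cnj S = S" by simp
  moreover have "S = a * V"
    unfolding S_def V_def v(3) using v(1) by (auto simp: sum_distrib_left mult_ac intro!: sum.cong)
  moreover have V: "V = complex_of_real (\<Sum>i<n. (cmod (v $ i))\<^sup>2)"
    unfolding V_def of_real_sum by (intro sum.cong refl) (simp only: complex_norm_square)
  moreover have "V \<noteq> 0"
  proof
    assume "V = 0"
    then have "(\<Sum>i<n. (cmod (v $ i))\<^sup>2) = 0" using V by (metis of_real_eq_0_iff)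
    then have "\<forall>i<n. v $ i = 0" by (subst (asm) sum_nonneg_eq_0_iff) auto
    then have "v = 0\<^sub>v n" using v(1) by (intro eq_vecI) auto
    then show False using v(2) by simp
  qed
  ultimately have "cnj a = a" by simp
  then obtain r where r: "a = complex_of_real r" by (metis Reals_cnj_iff Reals_cases)

  have "char_poly C = map_poly complex_of_real (char_poly A)"
    unfolding C_def by (rule of_real_hom.char_poly_hom[OF A])
  then have "complex_of_real (poly (char_poly A) r) = 0"
    using \<open>poly (char_poly C) a = 0\<close> r by simp
  then show ?thesis using eigenvalue_root_char_poly[OF A] by auto
qed

text \<open>Basis completion, Gram-Schmidt and normalization. Gram-Schmidt leaves the head
  \<open>v\<close> unchanged, so column 0 is a multiple of \<open>v\<close>.\<close>

lemma orthonormal_completion: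
  fixes v :: "real vec"
  assumes v: "v \<in> carrier_vec n" "v \<noteq> 0\<^sub>v n"
  obtains W c where "W \<in> carrier_mat n n" "transpose_mat W * W = 1\<^sub>m n" "col W 0 = c \<cdot>\<^sub>v v"
proof -
  have n: "n \<noteq> 0" using v by (cases n) auto
  define b where "b = basis_completion v"
  define ws where "ws = gram_schmidt n b"
  interpret cof_vec_space n "TYPE(real)" .
  from basis_completion[OF v, folded b_def]
  have span_b: "span (set b) = carrier_vec n" and dist_b: "distinct b" 
    and indep: "\<not> lin_dep (set b)" and b: "set b \<subseteq> carrier_vec n" and hdb: "hd b = v" 
    and len_b: "length b = n" by auto
  from hdb len_b n obtain vs where bv: "b = v # vs" by (cases b, auto)
  from gram_schmidt_result[OF b dist_b indep refl, folded ws_def]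
  have ws: "set ws \<subseteq> carrier_vec n" "corthogonal ws" "length ws = n" 
    by (auto simp: len_b)
  from gram_schmidt_hd[OF v(1), of vs, folded bv] have hdws: "hd ws = v" unfolding ws_def .
  define nw where "nw w = (1 / sqrt (w \<bullet> w)) \<cdot>\<^sub>v w" for w :: "real vec"
  define W where "W = mat_of_cols n (map nw ws)"
  have wsc: "ws ! i \<in> carrier_vec n" if "i < n" for i using ws that by auto
  have W: "W \<in> carrier_mat n n" using ws by (auto simp: W_def)
  have colW: "col W i = nw (ws ! i)" if "i < n" for i
    unfolding W_def using that ws wsc[OF that] by (subst col_mat_of_cols) (auto simp: nw_def)
  have orth: "ws ! i \<bullet> ws ! j = 0 \<longleftrightarrow> i \<noteq> j" if "i < n" "j < n" for i j
    using corthogonalD[OF ws(2)] ws(3) that by simp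
  have "col W i \<bullet> col W j = (if i = j then 1 else 0)" if "i < n" "j < n" for i j
  proof -
    have "col W i \<bullet> col W j
        = (1 / sqrt (ws ! i \<bullet> ws ! i)) * (1 / sqrt (ws ! j \<bullet> ws ! j)) * (ws ! i \<bullet> ws ! j)"
      using wsc[OF that(1)] wsc[OF that(2)] that
      by (simp add: colW nw_def smult_scalar_prod_distrib[of _ n] scalar_prod_smult_distrib[of _ n])
    moreover have "ws ! j \<bullet> ws ! j \<ge> 0"
      by (auto simp: scalar_prod_def intro!: sum_nonneg)
    then have "ws ! j \<bullet> ws ! j > 0" using orth[OF that(2) that(2)] by linarith
    ultimately show ?thesis using orth[OF that] by auto
  qed
  then have "transpose_mat W * W = 1\<^sub>m n" using W by (intro eq_matI) auto
  moreover have "col W 0 = (1 / sqrt (v \<bullet> v)) \<cdot>\<^sub>v v"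
    using colW[of 0] n hdws ws(3) by (cases ws) (auto simp: nw_def)
  ultimately show thesis using W that by blast
qed

lemma four_block_id:
  "1\<^sub>m (Suc n) = four_block_mat (1\<^sub>m 1) (0\<^sub>m 1 n) (0\<^sub>m n 1) (1\<^sub>m n)"
  by (rule eq_matI) auto

text \<open>Induction by deflation: an orthogonal change of basis puts an eigenvector first, which
  clears the first column below the diagonal. Symmetry then clears the first row as well, and the
  induction hypothesis diagonalizes the remaining block.\<close>

lemma spectral_theorem:
  fixes A :: "real mat"
  assumes "A \<in> carrier_mat n n" "transpose_mat A = A"
  obtains U d where "U \<in> carrier_mat n n" "transpose_mat U * U = 1\<^sub>m n"
    "transpose_mat U * A * U = mat n n (\<lambda>(i, j). if i = j then d i else 0)"
  using assms
proof (induction n arbitrary: A thesis)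
  case 0
  show ?case by (rule "0.prems"(1)[of "1\<^sub>m 0"]) (use "0.prems" in auto)
next
  case (Suc n)
  note A = Suc.prems(2) and sym = Suc.prems(3)
  obtain e v where v: "v \<in> carrier_vec (Suc n)" "v \<noteq> 0\<^sub>v (Suc n)" "A *\<^sub>v v = e \<cdot>\<^sub>v v"
    using symmetric_mat_real_eigenvalue[OF A sym] A unfolding eigenvalue_def eigenvector_def
    by auto
  obtain W c where W: "W \<in> carrier_mat (Suc n) (Suc n)" "transpose_mat W * W = 1\<^sub>m (Suc n)"
    and c: "col W 0 = c \<cdot>\<^sub>v v"
    using orthonormal_completion[OF v(1,2)] .
  have ev: "A *\<^sub>v col W 0 = e \<cdot>\<^sub>v col W 0"
    unfolding c using mult_mat_vec[OF A v(1), of c] v(3)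
    by (simp add: smult_smult_assoc mult.commute)
  define A' where "A' = transpose_mat W * A * W"
  have A': "A' \<in> carrier_mat (Suc n) (Suc n)" using A W by (simp add: A'_def)
  have symA': "transpose_mat A' = A'"
    unfolding A'_def using A W sym
    by (simp add: transpose_mult[of _ "Suc n" "Suc n" _ "Suc n"])
  have A'sym: "A' $$ (i, j) = A' $$ (j, i)" if "i < Suc n" "j < Suc n" for i j
    using arg_cong[OF symA', of "\<lambda>M. M $$ (i, j)"] that A' by simp
  have A'0: "A' $$ (i, 0) = (if i = 0 then e else 0)" if "i < Suc n" for i
  proof -
    have "A' $$ (i, 0) = (transpose_mat W * (A * W)) $$ (i, 0)"
      unfolding A'_def using A W by (subst assoc_mult_mat[of _ "Suc n" "Suc n" _ "Suc n" _ "Suc n"]) auto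
    also have "\<dots> = col W i \<bullet> (A *\<^sub>v col W 0)"
      using A W that col_mult2[OF A W(1), of 0] by simp
    also have "\<dots> = e * (col W i \<bullet> col W 0)" unfolding ev using W that by simp
    also have "col W i \<bullet> col W 0 = (transpose_mat W * W) $$ (i, 0)" using W(1) that by simp
    finally show ?thesis using W(2) that by simp
  qed
  define A3 where "A3 = mat n n (\<lambda>(i, j). A' $$ (Suc i, Suc j))"
  define E where "E = mat 1 1 (\<lambda>_. e)"
  have A3: "A3 \<in> carrier_mat n n" and E: "E \<in> carrier_mat 1 1" by (auto simp: A3_def E_def)
  have block: "A' = four_block_mat E (0\<^sub>m 1 n) (0\<^sub>m n 1) A3"
  proof (rule eq_matI)
    fix i j assume "i < dim_row (four_block_mat E (0\<^sub>m 1 n) (0\<^sub>m n 1) A3)"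
      and "j < dim_col (four_block_mat E (0\<^sub>m 1 n) (0\<^sub>m n 1) A3)"
    then have ij: "i < Suc n" "j < Suc n" using E A3 by auto
    show "A' $$ (i, j) = four_block_mat E (0\<^sub>m 1 n) (0\<^sub>m n 1) A3 $$ (i, j)"
      using ij A3 E A'0[OF ij(1)] A'0[OF ij(2)] A'sym[OF ij]
      by (cases i; cases j) (auto simp: A3_def E_def)
  qed (use A' A3 E in auto)
  have "transpose_mat A3 = A3"
    by (rule eq_matI) (auto simp: A3_def A'sym)
  then obtain U3 d3 where U3: "U3 \<in> carrier_mat n n" "transpose_mat U3 * U3 = 1\<^sub>m n"
    and d3: "transpose_mat U3 * A3 * U3 = mat n n (\<lambda>(i, j). if i = j then d3 i else 0)"
    using Suc.IH[OF _ A3] by blast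
  define F where "F = four_block_mat (1\<^sub>m 1) (0\<^sub>m 1 n) (0\<^sub>m n 1) U3"
  have F: "F \<in> carrier_mat (Suc n) (Suc n)"
    using four_block_carrier_mat[OF one_carrier_mat U3(1), of 1] by (simp add: F_def)
  have FT: "transpose_mat F = four_block_mat (1\<^sub>m 1) (0\<^sub>m 1 n) (0\<^sub>m n 1) (transpose_mat U3)"
    unfolding F_def by (subst transpose_four_block_mat) (use U3 in auto)
  have FF: "transpose_mat F * F = 1\<^sub>m (Suc n)"
    unfolding FT unfolding F_def four_block_id
    by (subst mult_four_block_mat[of _ 1 1 _ n _ n]) (use U3 in auto)
  have FTA': "transpose_mat F * A' = four_block_mat E (0\<^sub>m 1 n) (0\<^sub>m n 1) (transpose_mat U3 * A3)"
    unfolding FT block by (subst mult_four_block_mat[of _ 1 1 _ n _ n]) (use U3 A3 E in auto)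
  have FA'F: "transpose_mat F * A' * F
      = four_block_mat E (0\<^sub>m 1 n) (0\<^sub>m n 1) (transpose_mat U3 * A3 * U3)"
    unfolding FTA' unfolding F_def by (subst mult_four_block_mat[of _ 1 1 _ n _ n]) (use U3 A3 E in auto)
  define U where "U = W * F"
  have U: "U \<in> carrier_mat (Suc n) (Suc n)" using W F by (simp add: U_def)
  note assoc = assoc_mult_mat[of _ "Suc n" "Suc n" _ "Suc n" _ "Suc n"]
  have UT: "transpose_mat U = transpose_mat F * transpose_mat W"
    unfolding U_def using W F by (simp add: transpose_mult[of _ "Suc n" "Suc n" _ "Suc n"])
  have "transpose_mat W * (W * F) = F"
    using assoc_mult_mat[of "transpose_mat W" "Suc n" "Suc n" W "Suc n" F "Suc n"] W F by simp
  then have UU: "transpose_mat U * U = 1\<^sub>m (Suc n)"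
    unfolding UT unfolding U_def using W F FF by (simp add: assoc)
  have "transpose_mat U * A * U = transpose_mat F * A' * F"
    unfolding UT unfolding U_def A'_def using W F A by (simp add: assoc)
  also have "\<dots> = mat (Suc n) (Suc n)
      (\<lambda>(i, j). if i = j then (case i of 0 \<Rightarrow> e | Suc k \<Rightarrow> d3 k) else 0)"
    unfolding FA'F d3 by (rule eq_matI) (auto simp: E_def split: nat.splits)
  finally show ?case using Suc.prems(1)[OF U UU] by blast
qed

text \<open>\<open>kth_eigenvalue\<close> is read off the sorted roots of the characteristic
  polynomial. By similarity these are the diagonal entries as a multiset, so a permutation
  \<open>p\<close> aligns the orthonormal eigenvectors with the decreasing order. The shift
  \<open>Suc k\<close> reflects that eigenvalues are counted from 1.\<close>

lemma symmetric_mat_diagonalization: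
  fixes A :: "real mat"
  assumes A: "A \<in> carrier_mat n n" and sym: "transpose_mat A = A"
  obtains u where "\<And>k. k < n \<Longrightarrow> u k \<in> carrier_vec n" "\<And>k. k < n \<Longrightarrow> u k \<bullet> u k = 1"
    "\<And>x. x \<in> carrier_vec n \<Longrightarrow> x \<bullet> x = (\<Sum>k<n. (u k \<bullet> x)\<^sup>2)"
    "\<And>x. x \<in> carrier_vec n \<Longrightarrow>
      x \<bullet> (A *\<^sub>v x) = (\<Sum>k<n. kth_eigenvalue (Suc k) A * (u k \<bullet> x)\<^sup>2)"
    "\<And>j k. j \<le> k \<Longrightarrow> k < n \<Longrightarrow> kth_eigenvalue (Suc k) A \<le> kth_eigenvalue (Suc j) A"
proof -
  obtain U d where U: "U \<in> carrier_mat n n" and UU: "transpose_mat U * U = 1\<^sub>m n"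
    and D: "transpose_mat U * A * U = mat n n (\<lambda>(i, j). if i = j then d i else 0)"
    using spectral_theorem[OF A sym] .
  define D' where "D' = mat n n (\<lambda>(i, j). if i = j then d i else (0::real))"
  have D': "D' \<in> carrier_mat n n" by (simp add: D'_def)
  have UU': "U * transpose_mat U = 1\<^sub>m n"
    using mat_mult_left_right_inverse[OF _ U UU] U by simp
  have wit: "similar_mat_wit D' A (transpose_mat U) U"
    by (rule similar_mat_witI[of _ _ n]) (use U UU UU' A D D' in \<open>auto simp: D'_def\<close>)
  have "similar_mat D' A" using wit unfolding similar_mat_def by blast
  then have "char_poly A = char_poly D'" by (simp add: char_poly_similar)
  also have "\<dots> = (\<Prod>a\<leftarrow>diag_mat D'. [:- a, 1:])"
    by (rule char_poly_upper_triangular[OF D']) (auto simp: D'_def)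
  also have "diag_mat D' = map d [0..<n]" by (auto simp: diag_mat_def D'_def)
  finally have cp: "char_poly A = (\<Prod>a\<leftarrow>map d [0..<n]. [:- a, 1:])" .
  define es where "es = rev (sorted_list_of_multiset (proots (char_poly A)))"
  have prts: "proots (\<Prod>a\<leftarrow>xs. [:- a, 1:]) = mset xs" for xs :: "real list"
  proof (induction xs)
    case (Cons a xs)
    have "(\<Prod>a\<leftarrow>xs. [:- a, 1:]) \<noteq> (0 :: real poly)"
      by (auto simp: prod_list_zero_iff)
    then show ?case using Cons by (simp add: proots_mult del: mult_pCons_left)
  qed simp
  have mset_es: "mset es = mset (map d [0..<n])" unfolding es_def cp prts by simp
  then have len: "length es = n" by (metis size_mset length_map length_upt diff_zero)
  have k_es: "kth_eigenvalue (Suc k) A = es ! k" for k by (simp add: kth_eigenvalue_def es_def)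
  have mono: "es ! k \<le> es ! j" if "j \<le> k" "k < n" for j k
  proof -
    have "sorted_wrt (\<ge>) es" unfolding es_def sorted_wrt_rev by simp
    then show ?thesis using that len by (cases "j = k") (auto simp: sorted_wrt_iff_nth_less)
  qed
  obtain p where p: "p permutes {..<n}" "permute_list p (map d [0..<n]) = es"
    using mset_eq_permutation[OF mset_es] by auto
  have pn: "p k < n" if "k < n" for k using permutes_in_image[OF p(1)] that by auto
  have dp: "d (p k) = es ! k" if "k < n" for k
    using that pn[OF that] p by (auto simp: permute_list_def)
  define u where "u k = col U (p k)" for k
  have T: "transpose_mat U *\<^sub>v x \<in> carrier_vec n" if "x \<in> carrier_vec n" for x using U that by simp
  have Ti: "(transpose_mat U *\<^sub>v x) $ i = col U i \<bullet> x" if "i < n" for x i using U that by simp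
  have xx: "x = U *\<^sub>v (transpose_mat U *\<^sub>v x)" if "x \<in> carrier_vec n" for x
    using assoc_mult_mat_vec[of U n n "transpose_mat U" n x] U UU' that by simp
  have norm: "x \<bullet> x = (\<Sum>k<n. (u k \<bullet> x)\<^sup>2)" if x: "x \<in> carrier_vec n" for x
  proof -
    have "x \<bullet> x = x \<bullet> (U *\<^sub>v (transpose_mat U *\<^sub>v x))"
      by (rule arg_cong[OF xx[OF x], of "(\<bullet>) x"])
    also have "\<dots> = (transpose_mat U *\<^sub>v x) \<bullet> (transpose_mat U *\<^sub>v x)"
      by (rule transpose_vec_mult_scalar[OF U T[OF x] x, symmetric])
    also have "\<dots> = (\<Sum>i<n. (col U i \<bullet> x)\<^sup>2)"
      unfolding scalar_prod_def[of "transpose_mat U *\<^sub>v x" "transpose_mat U *\<^sub>v x"]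
      using U by (auto simp: power2_eq_square atLeast0LessThan intro!: sum.cong)
    also have "\<dots> = (\<Sum>k<n. (u k \<bullet> x)\<^sup>2)"
      unfolding u_def using sum.permute[OF p(1), of "\<lambda>i. (col U i \<bullet> x)\<^sup>2"] by (simp add: o_def)
    finally show ?thesis .
  qed
  have quad: "x \<bullet> (A *\<^sub>v x) = (\<Sum>k<n. es ! k * (u k \<bullet> x)\<^sup>2)" if x: "x \<in> carrier_vec n" for x
  proof -
    define y where "y = transpose_mat U *\<^sub>v x"
    have y: "y \<in> carrier_vec n" unfolding y_def by (rule T[OF x])
    have xy: "x = U *\<^sub>v y" unfolding y_def by (rule xx[OF x])
    have "D' *\<^sub>v y = transpose_mat U *\<^sub>v (A *\<^sub>v x)"
      unfolding D'_def D[symmetric] unfolding xy using U A y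
      by (simp add: assoc_mult_mat_vec[of _ n n _ n])
    moreover have "x \<bullet> (A *\<^sub>v x) = y \<bullet> (transpose_mat U *\<^sub>v (A *\<^sub>v x))"
      using transpose_vec_mult_scalar[of "transpose_mat U" n n "A *\<^sub>v x" y] U A x y
      unfolding xy by simp
    ultimately have "x \<bullet> (A *\<^sub>v x) = y \<bullet> (D' *\<^sub>v y)" by simp
    also have "\<dots> = (\<Sum>i<n. y $ i * (\<Sum>j<n. (if i = j then d i else 0) * y $ j))"
      using y by (auto simp: scalar_prod_def D'_def atLeast0LessThan intro!: sum.cong)
    also have "\<dots> = (\<Sum>i<n. d i * (col U i \<bullet> x)\<^sup>2)"
    proof (rule sum.cong[OF refl])
      fix i assume i: "i \<in> {..<n}"
      have "(\<Sum>j<n. (if i = j then d i else 0) * y $ j) = (\<Sum>j<n. if i = j then d i * y $ j else 0)"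
        by (rule sum.cong) auto
      also have "\<dots> = d i * y $ i" using i by simp
      finally show "y $ i * (\<Sum>j<n. (if i = j then d i else 0) * y $ j) = d i * (col U i \<bullet> x)\<^sup>2"
        using Ti[of i x] i by (simp add: y_def power2_eq_square)
    qed
    also have "\<dots> = (\<Sum>k<n. d (p k) * (u k \<bullet> x)\<^sup>2)"
      unfolding u_def using sum.permute[OF p(1), of "\<lambda>i. d i * (col U i \<bullet> x)\<^sup>2"] by (simp add: o_def)
    finally show ?thesis by (simp add: dp)
  qed
  show thesis
  proof (rule that[of u])
    fix k assume k: "k < n"
    show "u k \<in> carrier_vec n" using U pn[OF k] by (auto simp: u_def)
    have "u k \<bullet> u k = (transpose_mat U * U) $$ (p k, p k)" using U pn[OF k] by (simp add: u_def)
    then show "u k \<bullet> u k = 1" using UU pn[OF k] by simp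
  qed (use norm quad mono k_es in auto)
qed

lemma quadratic_form_le_top:
  fixes A :: "real mat"
  assumes A: "A \<in> carrier_mat n n" "transpose_mat A = A" and x: "x \<in> carrier_vec n"
  shows "x \<bullet> (A *\<^sub>v x) \<le> kth_eigenvalue 1 A * (x \<bullet> x)"
proof -
  show ?thesis
  proof (rule symmetric_mat_diagonalization[OF A])
    fix u assume u: "\<And>k. k < n \<Longrightarrow> u k \<in> carrier_vec n" "\<And>k. k < n \<Longrightarrow> u k \<bullet> u k = 1"
      "\<And>x. x \<in> carrier_vec n \<Longrightarrow> x \<bullet> x = (\<Sum>k<n. (u k \<bullet> x)\<^sup>2)"
      "\<And>x. x \<in> carrier_vec n \<Longrightarrow>
        x \<bullet> (A *\<^sub>v x) = (\<Sum>k<n. kth_eigenvalue (Suc k) A * (u k \<bullet> x)\<^sup>2)"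
      "\<And>j k. j \<le> k \<Longrightarrow> k < n \<Longrightarrow> kth_eigenvalue (Suc k) A \<le> kth_eigenvalue (Suc j) A"
    show ?thesis unfolding u(4)[OF x] unfolding u(3)[OF x] sum_distrib_left
      using u(5)[of 0] by (intro sum_mono mult_right_mono) auto
  qed
qed

text \<open>\<open>p\<close> is a top unit eigenvector, chosen before \<open>x\<close> and
  \<open>\<mu>\<close>; on its complement every eigenvalue is at most \<open>\<mu>\<close>. A free
  \<open>\<mu>\<close> is convenient because it is later a fixed fraction of the top eigenvalue. For
  \<open>n = 1\<close> the second eigenvalue is an arbitrary value, but the sum that it bounds is
  empty.\<close>

lemma quadratic_form_le_gap:
  fixes A :: "real mat"
  assumes A: "A \<in> carrier_mat n n" "transpose_mat A = A" and n: "0 < n"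
  obtains p where "p \<in> carrier_vec n" "p \<bullet> p = 1"
    "\<And>x \<mu>. x \<in> carrier_vec n \<Longrightarrow> kth_eigenvalue 2 A \<le> \<mu> \<Longrightarrow>
       x \<bullet> (A *\<^sub>v x) \<le> \<mu> * (x \<bullet> x) + (kth_eigenvalue 1 A - \<mu>) * (p \<bullet> x)\<^sup>2"
proof -
  show ?thesis
  proof (rule symmetric_mat_diagonalization[OF A])
    fix u assume u: "\<And>k. k < n \<Longrightarrow> u k \<in> carrier_vec n" "\<And>k. k < n \<Longrightarrow> u k \<bullet> u k = 1"
      "\<And>x. x \<in> carrier_vec n \<Longrightarrow> x \<bullet> x = (\<Sum>k<n. (u k \<bullet> x)\<^sup>2)"
      "\<And>x. x \<in> carrier_vec n \<Longrightarrow>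
        x \<bullet> (A *\<^sub>v x) = (\<Sum>k<n. kth_eigenvalue (Suc k) A * (u k \<bullet> x)\<^sup>2)"
      "\<And>j k. j \<le> k \<Longrightarrow> k < n \<Longrightarrow> kth_eigenvalue (Suc k) A \<le> kth_eigenvalue (Suc j) A"
    show thesis
    proof (rule that[of "u 0"])
      fix x :: "real vec" and \<mu> assume x: "x \<in> carrier_vec n" and \<mu>: "kth_eigenvalue 2 A \<le> \<mu>"
      have split: "{..<n} = insert 0 {1..<n}" using n by auto
      have "(\<Sum>k\<in>{1..<n}. kth_eigenvalue (Suc k) A * (u k \<bullet> x)\<^sup>2) \<le> (\<Sum>k\<in>{1..<n}. \<mu> * (u k \<bullet> x)\<^sup>2)"
        using u(5)[of 1] \<mu>
        by (intro sum_mono mult_right_mono) (auto simp: numeral_2_eq_2 intro: order_trans)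
      then show "x \<bullet> (A *\<^sub>v x) \<le> \<mu> * (x \<bullet> x) + (kth_eigenvalue 1 A - \<mu>) * (u 0 \<bullet> x)\<^sup>2"
        unfolding u(4)[OF x] unfolding u(3)[OF x] split
        by (simp add: algebra_simps sum_distrib_left)
    qed (use u n in auto)
  qed
qed

section \<open>Mean-field bounds for the partition function\<close>

text \<open>The Shannon entropy, in nats, of a spin with mean \<open>m\<close>. At the endpoints the
  vanishing factor in front of \<open>ln 0\<close> gives the correct value 0.\<close>

definition binary_entropy :: "real \<Rightarrow> real" where
  "binary_entropy m = - ((1 + m) / 2 * ln ((1 + m) / 2) + (1 - m) / 2 * ln ((1 - m) / 2))"

text \<open>For a matrix with zero diagonal and entries of \<open>m\<close> in [-1, 1] this is
  expected log-weight plus entropy under the product measure with mean vector \<open>m\<close>, the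
  functional of the Gibbs variational principle.\<close>

definition mean_field :: "real mat \<Rightarrow> real \<Rightarrow> real \<Rightarrow> (nat \<Rightarrow> real) \<Rightarrow> real" where
  "mean_field A \<beta> B m =
     \<beta> / 2 * (\<Sum>i<dim_row A. \<Sum>j<dim_row A. A $$ (i, j) * (m i * m j)) + B * (\<Sum>i<dim_row A. m i)
     + (\<Sum>i<dim_row A. binary_entropy (m i))"

text \<open>Dividing by \<open>sum w P\<close> makes passing to a subset the same as conditioning,
  so one weight \<open>w\<close> serves all subsets.\<close>

definition wmean :: "('a \<Rightarrow> real) \<Rightarrow> 'a set \<Rightarrow> ('a \<Rightarrow> real) \<Rightarrow> real" where
  "wmean w P f = (\<Sum>\<sigma>\<in>P. w \<sigma> * f \<sigma>) / sum w P"

lemma two_point_entropy_le: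
  fixes p q :: real
  assumes "0 < p" "0 < q" "p + q = 1"
  shows "- (p * ln p + q * ln q) \<le> ln 2"
proof -
  \<comment> \<open>The bound \<open>ln y \<le> y - 1\<close> at \<open>y = 1 / (2 * x)\<close>; the
    terms \<open>1 / 2 - x\<close> cancel when the two points are added.\<close>
  have *: "- (x * ln x) \<le> x * ln 2 + (1 / 2 - x)" if "x > 0" for x :: real
  proof -
    have "ln (1 / (2 * x)) \<le> 1 / (2 * x) - 1" using that by (intro ln_le_minus_one) auto
    then have "x * ln (1 / (2 * x)) \<le> x * (1 / (2 * x) - 1)" using that by (intro mult_left_mono) auto
    then show ?thesis using that by (simp add: ln_div ln_mult algebra_simps)
  qed
  have "- (p * ln p + q * ln q) \<le> (p + q) * ln 2 + (1 - (p + q))"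
    using *[OF assms(1)] *[OF assms(2)] by (simp add: algebra_simps)
  then show ?thesis using assms(3) by simp
qed

lemma wmean_abs_le_one:
  assumes "finite P" "P \<noteq> {}" "\<And>\<sigma>. \<sigma> \<in> P \<Longrightarrow> w \<sigma> > 0" "\<And>\<sigma>. \<sigma> \<in> P \<Longrightarrow> f \<sigma> \<in> {-1, 1 :: real}"
  shows "\<bar>wmean w P f\<bar> \<le> 1"
proof -
  have Z: "sum w P > 0" using assms by (intro sum_pos) auto
  have "\<bar>\<Sum>\<sigma>\<in>P. w \<sigma> * f \<sigma>\<bar> \<le> (\<Sum>\<sigma>\<in>P. w \<sigma>)"
    using assms(3,4) by (intro order_trans[OF sum_abs] sum_mono) (fastforce simp: abs_mult)
  then show ?thesis using Z by (simp add: wmean_def abs_divide)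
qed

text \<open>The pinning argument. Splitting a set \<open>P\<close> by the value of \<open>X j\<close> costs at most \<open>ln 2\<close> in the
  logarithm of its weight and lowers the average of the total variance by at least the sum of the
  squared covariances with \<open>X j\<close>; a subset maximizing the log-weight minus a multiple of the total
  variance therefore has small covariances.\<close>

lemma low_covariance_subset:
  fixes w :: "'a \<Rightarrow> real" and X :: "nat \<Rightarrow> 'a \<Rightarrow> real" and l :: real
  assumes fin: "finite J" and ne: "J \<noteq> {}" and w: "\<And>\<sigma>. \<sigma> \<in> J \<Longrightarrow> w \<sigma> > 0"
    and X: "\<And>i \<sigma>. i < n \<Longrightarrow> \<sigma> \<in> J \<Longrightarrow> X i \<sigma> \<in> {-1, 1}" and l: "l > 0" and n: "n > 0"
  obtains P where "P \<subseteq> J" "P \<noteq> {}" "ln (sum w J) \<le> ln (sum w P) + l * ln 2"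
    "\<And>j. j < n \<Longrightarrow>
      (\<Sum>i<n. (wmean w P (\<lambda>\<sigma>. X i \<sigma> * X j \<sigma>) - wmean w P (X i) * wmean w P (X j))\<^sup>2) \<le> n / l"
proof -
  define V where "V P = (\<Sum>i<n. 1 - (wmean w P (X i))\<^sup>2)" for P
  \<comment> \<open>The constant meets two demands: since \<open>V\<close> lies between 0 and
    \<open>n\<close>, at most \<open>\<kappa> * n = l * ln 2\<close> of log-weight is lost, and the
    covariance bound comes out as \<open>ln 2 / \<kappa> = n / l\<close>.\<close>
  define \<kappa> where "\<kappa> = l * ln 2 / n"
  define G where "G P = ln (sum w P) - \<kappa> * V P" for P
  have \<kappa>: "\<kappa> > 0" using l n by (simp add: \<kappa>_def)
  have fS: "finite (Pow J - {{}})" and neS: "Pow J - {{}} \<noteq> {}" using fin ne by auto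
  obtain P where P0: "P \<in> Pow J - {{}}" and max0: "\<And>Q. Q \<in> Pow J - {{}} \<Longrightarrow> G Q \<le> G P"
    using obtains_MAX[OF fS neS, of G] fS by (metis Max_ge finite_imageI imageI)
  then have P: "P \<subseteq> J" "P \<noteq> {}" and max: "\<And>Q. Q \<subseteq> J \<Longrightarrow> Q \<noteq> {} \<Longrightarrow> G Q \<le> G P" by auto
  have finP: "finite P" using P fin finite_subset by blast
  have wP: "w \<sigma> > 0" if "\<sigma> \<in> P" for \<sigma> using w that P by auto
  have m1: "(wmean w Q (X i))\<^sup>2 \<le> 1" if "Q \<subseteq> J" "Q \<noteq> {}" "i < n" for Q i
    using wmean_abs_le_one[of Q w "X i"] that finite_subset[OF that(1) fin] w X
    by (auto simp: abs_square_le_1)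
  have "ln (sum w J) \<le> ln (sum w P) + l * ln 2"
  proof -
    have "V J \<le> (\<Sum>i<n. 1)" unfolding V_def by (intro sum_mono) auto
    then have "V J \<le> n" by simp
    moreover have "V P \<ge> 0" unfolding V_def using m1 P by (intro sum_nonneg) auto
    ultimately have "\<kappa> * (V J - V P) \<le> \<kappa> * n" using \<kappa> by (intro mult_left_mono) auto
    also have "\<dots> = l * ln 2" using n by (simp add: \<kappa>_def)
    finally show ?thesis using max[OF order_refl ne] by (simp add: G_def algebra_simps)
  qed
  moreover have "(\<Sum>i<n. (wmean w P (\<lambda>\<sigma>. X i \<sigma> * X j \<sigma>) - wmean w P (X i) * wmean w P (X j))\<^sup>2) \<le> n / l"
    if j: "j < n" for j
  proof -
    define Pp where "Pp = {\<sigma> \<in> P. X j \<sigma> = 1}"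
    define Pm where "Pm = {\<sigma> \<in> P. X j \<sigma> = -1}"
    have un: "P = Pp \<union> Pm" and dis: "Pp \<inter> Pm = {}"
      using X[OF j] P by (fastforce simp: Pp_def Pm_def)+
    have finpm: "finite Pp" "finite Pm" using finP un by auto
    have split: "sum f P = sum f Pp + sum f Pm" for f :: "'a \<Rightarrow> real"
      unfolding un by (rule sum.union_disjoint[OF finpm dis])
    define Z Zp Zm where "Z = sum w P" and "Zp = sum w Pp" and "Zm = sum w Pm"
    have Z: "Z > 0" unfolding Z_def using finP P wP by (intro sum_pos) auto
    have Zs: "Z = Zp + Zm" unfolding Z_def Zp_def Zm_def by (rule split)
    show ?thesis
    \<comment> \<open>An empty half cannot compete in the maximization, but then \<open>X j\<close>
      is constant on \<open>P\<close> and its covariances vanish.\<close>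
    proof (cases "Pp = {} \<or> Pm = {}")
      case True
      then have "(\<forall>\<sigma>\<in>P. X j \<sigma> = -1) \<or> (\<forall>\<sigma>\<in>P. X j \<sigma> = 1)"
        using X[OF j] P(1) unfolding Pp_def Pm_def by blast
      then obtain c where c: "\<And>\<sigma>. \<sigma> \<in> P \<Longrightarrow> X j \<sigma> = c" by blast
      have "wmean w P (\<lambda>\<sigma>. X i \<sigma> * X j \<sigma>) = wmean w P (X i) * wmean w P (X j)" for i
      proof -
        have "(\<Sum>\<sigma>\<in>P. w \<sigma> * (X i \<sigma> * X j \<sigma>)) = (\<Sum>\<sigma>\<in>P. w \<sigma> * X i \<sigma>) * c"
          unfolding sum_distrib_right by (intro sum.cong) (auto simp: c)
        moreover have "(\<Sum>\<sigma>\<in>P. w \<sigma> * X j \<sigma>) = Z * c"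
          unfolding sum_distrib_right Z_def by (intro sum.cong) (auto simp: c)
        ultimately show ?thesis using Z by (simp add: wmean_def Z_def)
      qed
      then show ?thesis using l by simp
    next
      case False
      then have nep: "Pp \<noteq> {}" "Pm \<noteq> {}" by auto
      have Zpm: "Zp > 0" "Zm > 0" unfolding Zp_def Zm_def
        using nep finpm wP un by (auto intro!: sum_pos)
      define p q where "p = Zp / Z" and "q = Zm / Z"
      have pq: "p > 0" "q > 0" "p + q = 1"
        using Zpm Z Zs by (auto simp: p_def q_def add_divide_distrib[symmetric])
      define a b where "a i = wmean w Pp (X i)" and "b i = wmean w Pm (X i)" for i
      have sp: "(\<Sum>\<sigma>\<in>Pp. w \<sigma> * X i \<sigma>) = Zp * a i" "(\<Sum>\<sigma>\<in>Pm. w \<sigma> * X i \<sigma>) = Zm * b i" for i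
        using Zpm by (auto simp: a_def b_def wmean_def Zp_def Zm_def)
      have spj: "(\<Sum>\<sigma>\<in>Pp. w \<sigma> * (f \<sigma> * X j \<sigma>)) = (\<Sum>\<sigma>\<in>Pp. w \<sigma> * f \<sigma>)"
        "(\<Sum>\<sigma>\<in>Pm. w \<sigma> * (f \<sigma> * X j \<sigma>)) = - (\<Sum>\<sigma>\<in>Pm. w \<sigma> * f \<sigma>)" for f
        unfolding sum_negf[symmetric] by (intro sum.cong; auto simp: Pp_def Pm_def)+
      have mi: "wmean w P (X i) = p * a i + q * b i" for i
        unfolding wmean_def split[of "\<lambda>\<sigma>. w \<sigma> * X i \<sigma>"] sp Z_def[symmetric]
        by (simp add: p_def q_def add_divide_distrib)
      have mij: "wmean w P (\<lambda>\<sigma>. X i \<sigma> * X j \<sigma>) = p * a i - q * b i" for i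
        unfolding wmean_def split[of "\<lambda>\<sigma>. w \<sigma> * (X i \<sigma> * X j \<sigma>)"] spj sp Z_def[symmetric]
        by (simp add: p_def q_def diff_divide_distrib)
      have mj: "wmean w P (X j) = p - q"
        using spj[of "\<lambda>_. 1"]
        unfolding wmean_def split[of "\<lambda>\<sigma>. w \<sigma> * X j \<sigma>"] Z_def[symmetric]
        by (simp add: p_def q_def diff_divide_distrib Zp_def Zm_def)
      have q1: "q = 1 - p" using pq by simp
      \<comment> \<open>Both the covariance and the drop in variance are governed by the difference
        of the conditional means: \<open>2 * p * q * (a i - b i)\<close> against
        \<open>p * q * (a i - b i)\<^sup>2\<close>. Since \<open>4 * p * q \<le> 1\<close>, the
        square of the former is at most the latter.\<close>
      have cov: "wmean w P (\<lambda>\<sigma>. X i \<sigma> * X j \<sigma>) - wmean w P (X i) * wmean w P (X j)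
          = 2 * (p * q) * (a i - b i)" for i
        unfolding mj unfolding mi mij q1 by (simp add: algebra_simps)
      have pq4: "4 * (p * q) \<le> 1"
        unfolding q1 using sum_squares_ge_zero[of "2 * p - 1" 0] by (simp add: algebra_simps)
      have sq: "(2 * (p * q) * (a i - b i))\<^sup>2 \<le> p * q * (a i - b i)\<^sup>2" for i
      proof -
        have "(2 * (p * q) * (a i - b i))\<^sup>2 = (4 * (p * q)) * (p * q * (a i - b i)\<^sup>2)"
          by (simp add: power2_eq_square)
        also have "\<dots> \<le> 1 * (p * q * (a i - b i)\<^sup>2)"
          using pq4 pq by (intro mult_right_mono) auto
        finally show ?thesis by simp
      qed
      \<comment> \<open>The law of total variance, conditioning on the value of
        \<open>X j\<close>.\<close>
      have V: "V P = p * V Pp + q * V Pm + (\<Sum>i<n. p * q * (a i - b i)\<^sup>2)"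
        unfolding V_def sum_distrib_left sum.distrib[symmetric] mi a_def[symmetric] b_def[symmetric]
        by (intro sum.cong refl) (simp add: q1 power2_eq_square algebra_simps)
      \<comment> \<open>Maximality is used for both halves and averaged with the weights
        \<open>p\<close> and \<open>q\<close>: the average log-weight drops by the entropy of
        (\<open>p\<close>, \<open>q\<close>), so the average variance cannot drop by more than that
        divided by \<open>\<kappa>\<close>.\<close>
      have "G Pp \<le> G P" "G Pm \<le> G P" using max nep un P by auto
      then have "p * G Pp + q * G Pm \<le> p * G P + q * G P"
        using pq by (intro add_mono mult_left_mono) auto
      also have "\<dots> = G P" using pq by (simp add: distrib_right[symmetric])
      finally have 1: "p * G Pp + q * G Pm \<le> G P" .
      have lns: "ln (sum w Pp) = ln Z + ln p" "ln (sum w Pm) = ln Z + ln q"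
        using Z Zpm by (auto simp: p_def q_def ln_div Zp_def[symmetric] Zm_def[symmetric])
      have "p * G Pp + q * G Pm
          = ln Z + (p * ln p + q * ln q) - \<kappa> * (p * V Pp + q * V Pm)"
        unfolding G_def lns q1 by (simp add: algebra_simps)
      then have "\<kappa> * (\<Sum>i<n. p * q * (a i - b i)\<^sup>2) \<le> - (p * ln p + q * ln q)"
        using 1 unfolding G_def[of P] V Z_def[symmetric] by (simp add: algebra_simps)
      also have "\<dots> \<le> ln 2" by (rule two_point_entropy_le[OF pq])
      finally have "(\<Sum>i<n. p * q * (a i - b i)\<^sup>2) \<le> ln 2 / \<kappa>"
        using \<kappa> by (simp add: field_simps)
      also have "\<dots> = n / l" by (simp add: \<kappa>_def)
      finally have "(\<Sum>i<n. p * q * (a i - b i)\<^sup>2) \<le> n / l" .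
      then show ?thesis unfolding cov by (intro order_trans[OF sum_mono[OF sq]])
    qed
  qed
  ultimately show thesis using that P by blast
qed

text \<open>Nonnegativity of relative entropy, from \<open>ln y \<le> y - 1\<close>. The weight
  \<open>r\<close> may have smaller total mass than \<open>q\<close>, as happens when a product
  measure is restricted to a subset of the configurations.\<close>

lemma gibbs_inequality:
  fixes q r :: "'a \<Rightarrow> real"
  assumes "\<And>s. s \<in> S \<Longrightarrow> q s > 0" "\<And>s. s \<in> S \<Longrightarrow> r s > 0" "sum r S \<le> sum q S"
  shows "(\<Sum>s\<in>S. q s * ln (r s)) \<le> (\<Sum>s\<in>S. q s * ln (q s))"
proof -
  have "(\<Sum>s\<in>S. q s * ln (r s)) \<le> (\<Sum>s\<in>S. q s * ln (q s) + (r s - q s))"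
  proof (rule sum_mono)
    fix s assume s: "s \<in> S"
    have "ln (r s / q s) \<le> r s / q s - 1" using assms(1,2)[OF s] by (intro ln_le_minus_one) auto
    then have "q s * ln (r s / q s) \<le> q s * (r s / q s - 1)"
      using assms(1)[OF s] by (intro mult_left_mono) auto
    then show "q s * ln (r s) \<le> q s * ln (q s) + (r s - q s)"
      using assms(1,2)[OF s] by (simp add: ln_div algebra_simps)
  qed
  then show ?thesis using assms(3) by (simp add: sum.distrib sum_subtractf)
qed

section \<open>Product measures on spin configurations\<close>

lemma sum_spins_prod:
  fixes f :: "nat \<Rightarrow> real \<Rightarrow> real"
  shows "(\<Sum>\<sigma>\<in>spins n. \<Prod>k<n. f k (\<sigma> $ k)) = (\<Prod>k<n. f k 1 + f k (-1))"
proof -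
  have "(\<Prod>k<n. f k 1 + f k (-1)) = (\<Prod>k<n. \<Sum>s\<in>{-1, 1}. f k s)" by (simp add: add.commute)
  also have "\<dots> = (\<Sum>g\<in>{..<n} \<rightarrow>\<^sub>E {-1, 1}. \<Prod>k<n. f k (g k))"
    by (rule prod_sum_PiE) auto
  also have "\<dots> = (\<Sum>\<sigma>\<in>spins n. \<Prod>k<n. f k (\<sigma> $ k))"
  proof (rule sum.reindex_bij_witness[where i = "\<lambda>\<sigma>. restrict (\<lambda>i. \<sigma> $ i) {..<n}" and j = "vec n"])
    fix g :: "nat \<Rightarrow> real" assume g: "g \<in> {..<n} \<rightarrow>\<^sub>E {-1, 1}"
    show "restrict (\<lambda>i. vec n g $ i) {..<n} = g"
      using g by (auto simp: PiE_def extensional_def)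
    show "vec n g \<in> spins n" using g by (auto simp: spins_def PiE_iff)
    show "(\<Prod>k<n. f k (vec n g $ k)) = (\<Prod>k<n. f k (g k))" by simp
  next
    fix \<sigma> assume s: "\<sigma> \<in> spins n"
    show "vec n (restrict (\<lambda>i. \<sigma> $ i) {..<n}) = \<sigma>"
      using s by (intro eq_vecI) (auto simp: spins_def)
    show "restrict (\<lambda>i. \<sigma> $ i) {..<n} \<in> {..<n} \<rightarrow>\<^sub>E {-1, 1}"
      using s by (auto simp: spins_def)
  qed
  finally show ?thesis by simp
qed

text \<open>On {-1, 1} every function is affine, so its expectation is determined by the mean of the
  spin.\<close>

lemma sum_spin_observable:
  fixes q :: "real vec \<Rightarrow> real" and g :: "real \<Rightarrow> real"
  assumes S: "S \<subseteq> spins n" "sum q S = 1" and i: "i < n" and m: "(\<Sum>\<sigma>\<in>S. q \<sigma> * \<sigma> $ i) = m"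
  shows "(\<Sum>\<sigma>\<in>S. q \<sigma> * g (\<sigma> $ i)) = (1 + m) / 2 * g 1 + (1 - m) / 2 * g (-1)"
proof -
  have "(\<Sum>\<sigma>\<in>S. q \<sigma> * g (\<sigma> $ i))
      = (\<Sum>\<sigma>\<in>S. q \<sigma> * ((g 1 + g (-1)) / 2) + q \<sigma> * \<sigma> $ i * ((g 1 - g (-1)) / 2))"
  proof (rule sum.cong[OF refl])
    fix \<sigma> assume "\<sigma> \<in> S"
    then have "\<sigma> $ i \<in> {-1, 1}" using S i by (auto simp: spins_def)
    then show "q \<sigma> * g (\<sigma> $ i)
        = q \<sigma> * ((g 1 + g (-1)) / 2) + q \<sigma> * \<sigma> $ i * ((g 1 - g (-1)) / 2)"
      by (auto simp: field_simps)
  qed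
  also have "\<dots> = (g 1 + g (-1)) / 2 + m * ((g 1 - g (-1)) / 2)"
    unfolding sum.distrib sum_distrib_right[symmetric] m S(2) by simp
  finally show ?thesis by (simp add: field_simps)
qed

text \<open>The product measure with means \<open>m k\<close>: for a spin value \<open>s\<close> the
  factor \<open>(1 + m k * s) / 2\<close> is the probability of \<open>s\<close>.\<close>

definition spin_product :: "nat \<Rightarrow> (nat \<Rightarrow> real) \<Rightarrow> real vec \<Rightarrow> real" where
  "spin_product n m \<sigma> = (\<Prod>k<n. (1 + m k * \<sigma> $ k) / 2)"

lemma sum_spin_product: "(\<Sum>\<sigma>\<in>spins n. spin_product n m \<sigma>) = 1"
proof -
  have "(\<Sum>\<sigma>\<in>spins n. spin_product n m \<sigma>) = (\<Prod>k<n. (1 + m k * 1) / 2 + (1 + m k * -1) / 2)"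
    unfolding spin_product_def by (rule sum_spins_prod)
  also have "\<dots> = (\<Prod>k<n. 1)" by (intro prod.cong) (auto simp: field_simps)
  finally show ?thesis by simp
qed

text \<open>Writing the monomial over \<open>K\<close> as a product over all sites keeps the sum
  factorized; singletons give the means and two-element sets the pair moments.\<close>

lemma sum_spin_product_prod:
  "(\<Sum>\<sigma>\<in>spins n. spin_product n m \<sigma> * (\<Prod>k<n. if k \<in> K then \<sigma> $ k else 1))
     = (\<Prod>k<n. if k \<in> K then m k else 1)"
proof -
  have "(\<Sum>\<sigma>\<in>spins n. spin_product n m \<sigma> * (\<Prod>k<n. if k \<in> K then \<sigma> $ k else 1))
      = (\<Sum>\<sigma>\<in>spins n. \<Prod>k<n. (1 + m k * \<sigma> $ k) / 2 * (if k \<in> K then \<sigma> $ k else 1))"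
    unfolding spin_product_def prod.distrib ..
  also have "\<dots> = (\<Prod>k<n. (1 + m k * 1) / 2 * (if k \<in> K then 1 else 1)
      + (1 + m k * -1) / 2 * (if k \<in> K then -1 else 1))"
    by (rule sum_spins_prod)
  also have "\<dots> = (\<Prod>k<n. if k \<in> K then m k else 1)"
    by (intro prod.cong) (auto simp: field_simps)
  finally show ?thesis .
qed

text \<open>The logarithm of a product density is a sum of one-spin functions, so its expectation
  under any \<open>q\<close>, product or not, depends only on the means. Positivity of the factors
  is what lets the logarithm split.\<close>

lemma sum_ln_spin_product:
  assumes S: "S \<subseteq> spins n" "sum q S = 1"
    and m: "\<And>i. i < n \<Longrightarrow> (\<Sum>\<sigma>\<in>S. q \<sigma> * \<sigma> $ i) = m i"
    and pos: "\<And>i \<sigma>. \<sigma> \<in> S \<Longrightarrow> i < n \<Longrightarrow> 0 < 1 + m i * \<sigma> $ i"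
  shows "(\<Sum>\<sigma>\<in>S. q \<sigma> * ln (spin_product n m \<sigma>)) = - (\<Sum>i<n. binary_entropy (m i))"
proof -
  have "(\<Sum>\<sigma>\<in>S. q \<sigma> * ln (spin_product n m \<sigma>))
      = (\<Sum>\<sigma>\<in>S. \<Sum>i<n. q \<sigma> * ln ((1 + m i * \<sigma> $ i) / 2))"
    unfolding sum_distrib_left[symmetric] spin_product_def
  proof (intro sum.cong refl arg_cong2[where f = "(*)"])
    fix \<sigma> assume s: "\<sigma> \<in> S"
    show "ln (\<Prod>k<n. (1 + m k * \<sigma> $ k) / 2) = (\<Sum>k<n. ln ((1 + m k * \<sigma> $ k) / 2))"
      by (rule ln_prod) (use pos[OF s] in force)+
  qed
  also have "\<dots> = (\<Sum>i<n. \<Sum>\<sigma>\<in>S. q \<sigma> * ln ((1 + m i * \<sigma> $ i) / 2))" by (rule sum.swap)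
  also have "\<dots> = (\<Sum>i<n. - binary_entropy (m i))"
  proof (rule sum.cong[OF refl])
    fix i assume "i \<in> {..<n}"
    then show "(\<Sum>\<sigma>\<in>S. q \<sigma> * ln ((1 + m i * \<sigma> $ i) / 2)) = - binary_entropy (m i)"
      using sum_spin_observable[OF S, of i "m i" "\<lambda>s. ln ((1 + m i * s) / 2)"] m
      by (simp add: binary_entropy_def)
  qed
  finally show ?thesis by (simp add: sum_negf)
qed

section \<open>Lower and upper variational bounds\<close>

lemma quadratic_form_sum:
  fixes A :: "real mat"
  assumes "A \<in> carrier_mat n n" "x \<in> carrier_vec n"
  shows "x \<bullet> (A *\<^sub>v x) = (\<Sum>i<n. \<Sum>j<n. A $$ (i, j) * (x $ i * x $ j))"
  using assms
  by (auto simp: scalar_prod_def sum_distrib_left atLeast0LessThan mult_ac intro!: sum.cong)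

lemma ln_ising_weight:
  assumes "A \<in> carrier_mat n n" "\<sigma> \<in> spins n"
  shows "ln (ising_weight A \<beta> B \<sigma>)
    = \<beta> / 2 * (\<Sum>i<n. \<Sum>j<n. A $$ (i, j) * (\<sigma> $ i * \<sigma> $ j)) + B * (\<Sum>i<n. \<sigma> $ i)"
proof -
  have "\<sigma> \<in> carrier_vec n" using assms(2) by (simp add: spins_def)
  then show ?thesis by (simp add: ising_weight_def quadratic_form_sum[OF assms(1)])
qed

lemma sum_ln_ising_weight:
  assumes A: "A \<in> carrier_mat n n" and S: "S \<subseteq> spins n"
  shows "(\<Sum>\<sigma>\<in>S. q \<sigma> * ln (ising_weight A \<beta> B \<sigma>))
    = \<beta> / 2 * (\<Sum>i<n. \<Sum>j<n. A $$ (i, j) * (\<Sum>\<sigma>\<in>S. q \<sigma> * (\<sigma> $ i * \<sigma> $ j)))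
      + B * (\<Sum>i<n. \<Sum>\<sigma>\<in>S. q \<sigma> * \<sigma> $ i)"
proof -
  have "(\<Sum>\<sigma>\<in>S. q \<sigma> * ln (ising_weight A \<beta> B \<sigma>))
     = (\<Sum>\<sigma>\<in>S. \<beta> / 2 * (\<Sum>i<n. \<Sum>j<n. A $$ (i, j) * (q \<sigma> * (\<sigma> $ i * \<sigma> $ j)))
          + B * (\<Sum>i<n. q \<sigma> * \<sigma> $ i))"
    using S by (intro sum.cong refl, subst ln_ising_weight[OF A])
      (auto simp: algebra_simps sum_distrib_left)
  also have "\<dots> = \<beta> / 2 * (\<Sum>\<sigma>\<in>S. \<Sum>i<n. \<Sum>j<n. A $$ (i, j) * (q \<sigma> * (\<sigma> $ i * \<sigma> $ j)))
          + B * (\<Sum>\<sigma>\<in>S. \<Sum>i<n. q \<sigma> * \<sigma> $ i)"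
    by (simp add: sum.distrib sum_distrib_left)
  also have "(\<Sum>\<sigma>\<in>S. \<Sum>i<n. q \<sigma> * \<sigma> $ i) = (\<Sum>i<n. \<Sum>\<sigma>\<in>S. q \<sigma> * \<sigma> $ i)"
    by (rule sum.swap)
  also have "(\<Sum>\<sigma>\<in>S. \<Sum>i<n. \<Sum>j<n. A $$ (i, j) * (q \<sigma> * (\<sigma> $ i * \<sigma> $ j)))
      = (\<Sum>i<n. \<Sum>j<n. \<Sum>\<sigma>\<in>S. A $$ (i, j) * (q \<sigma> * (\<sigma> $ i * \<sigma> $ j)))"
    by (subst sum.swap, intro sum.cong refl, rule sum.swap)
  finally show ?thesis by (simp add: sum_distrib_left)
qed

text \<open>The Gibbs variational principle with the product measure of constant mean
  \<open>t\<close> as trial measure. The zero diagonal matters: the second moment of a single spin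
  is 1, not \<open>t * t\<close>.\<close>

lemma ln_ising_Z_ge:
  assumes A: "coupling_matrix n A" and t: "\<bar>t\<bar> < 1"
  shows "mean_field A \<beta> B (\<lambda>_. t) \<le> ln (ising_Z A \<beta> B)"
proof -
  have Ac: "A \<in> carrier_mat n n" and diag: "\<And>i. i < n \<Longrightarrow> A $$ (i, i) = 0"
    using A by (auto simp: coupling_matrix_def)
  have dim: "dim_row A = n" using Ac by simp
  define \<pi> where "\<pi> = spin_product n (\<lambda>_. t)"
  have sum\<pi>: "sum \<pi> (spins n) = 1" unfolding \<pi>_def by (rule sum_spin_product)
  have f: "0 < 1 + t * \<sigma> $ i" if "\<sigma> \<in> spins n" "i < n" for \<sigma> i
  proof -
    have "\<sigma> $ i \<in> {-1, 1}" using that by (auto simp: spins_def)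
    then show ?thesis using t by auto
  qed
  have pos: "\<pi> \<sigma> > 0" if "\<sigma> \<in> spins n" for \<sigma>
    unfolding \<pi>_def spin_product_def using f[OF that] by (intro prod_pos) auto
  have mi: "(\<Sum>\<sigma>\<in>spins n. \<pi> \<sigma> * \<sigma> $ i) = t" if "i < n" for i
    using sum_spin_product_prod[of n "\<lambda>_. t" "{i}"] that by (simp add: \<pi>_def)
  have mij: "(\<Sum>\<sigma>\<in>spins n. \<pi> \<sigma> * (\<sigma> $ i * \<sigma> $ j)) = t * t" if "i < n" "j < n" "i \<noteq> j" for i j
  proof -
    have "(\<Prod>k<n. if k \<in> {i, j} then y k else 1) = y i * y j" for y :: "nat \<Rightarrow> real"
    proof -
      have "(\<Prod>k<n. if k \<in> {i, j} then y k else 1) = (\<Prod>k\<in>{i, j}. y k)"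
        using that by (intro prod.mono_neutral_cong_right) auto
      then show ?thesis using that by simp
    qed
    then show ?thesis using sum_spin_product_prod[of n "\<lambda>_. t" "{i, j}"] by (simp add: \<pi>_def)
  qed
  define Z where "Z = ising_Z A \<beta> B"
  have Z: "Z > 0" unfolding Z_def by (rule ising_Z_pos)
  have wpos: "ising_weight A \<beta> B \<sigma> > 0" for \<sigma> by (simp add: ising_weight_def)
  have "(\<Sum>\<sigma>\<in>spins n. \<pi> \<sigma> * ln (ising_weight A \<beta> B \<sigma> / Z)) \<le> (\<Sum>\<sigma>\<in>spins n. \<pi> \<sigma> * ln (\<pi> \<sigma>))"
  proof (rule gibbs_inequality)
    show "(\<Sum>\<sigma>\<in>spins n. ising_weight A \<beta> B \<sigma> / Z) \<le> sum \<pi> (spins n)"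
      unfolding sum\<pi> sum_divide_distrib[symmetric] using Z by (simp add: Z_def ising_Z_def dim)
  qed (use pos wpos Z in auto)
  also have "\<dots> = - (\<Sum>i<n. binary_entropy t)"
    using sum_ln_spin_product[OF order_refl sum\<pi>, of "\<lambda>_. t"] mi f by (simp add: \<pi>_def)
  also have "(\<Sum>\<sigma>\<in>spins n. \<pi> \<sigma> * ln (ising_weight A \<beta> B \<sigma> / Z))
      = (\<Sum>\<sigma>\<in>spins n. \<pi> \<sigma> * ln (ising_weight A \<beta> B \<sigma>)) - ln Z"
    unfolding ln_divide_pos[OF wpos Z] right_diff_distrib sum_subtractf sum_distrib_right[symmetric] sum\<pi>
    by simp
  also have "(\<Sum>\<sigma>\<in>spins n. \<pi> \<sigma> * ln (ising_weight A \<beta> B \<sigma>))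
      = \<beta> / 2 * (\<Sum>i<n. \<Sum>j<n. A $$ (i, j) * (t * t)) + B * (\<Sum>i<n. t)"
  proof -
    have "A $$ (i, j) * (\<Sum>\<sigma>\<in>spins n. \<pi> \<sigma> * (\<sigma> $ i * \<sigma> $ j)) = A $$ (i, j) * (t * t)"
      if "i < n" "j < n" for i j using mij[OF that] diag that by (cases "i = j") auto
    then have "(\<Sum>i<n. \<Sum>j<n. A $$ (i, j) * (\<Sum>\<sigma>\<in>spins n. \<pi> \<sigma> * (\<sigma> $ i * \<sigma> $ j)))
        = (\<Sum>i<n. \<Sum>j<n. A $$ (i, j) * (t * t))"
      by (intro sum.cong refl) auto
    then show ?thesis unfolding sum_ln_ising_weight[OF Ac order_refl] by (simp add: mi)
  qed
  finally show ?thesis unfolding mean_field_def dim Z_def by simp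
qed

text \<open>The two error terms pull \<open>l\<close> in opposite directions:
  \<open>l * ln 2\<close> is the log-weight given up by pinning, the Frobenius term is what the
  remaining covariances can contribute to the energy. The choice of \<open>l\<close> is left to the
  application.\<close>

lemma ln_sum_ising_weight_le:
  assumes A: "A \<in> carrier_mat n n" and n: "n > 0" and \<beta>: "\<beta> \<ge> 0" and l: "l > 0"
    and J: "J \<subseteq> spins n" "J \<noteq> {}" and C: "convex C" "\<And>\<sigma>. \<sigma> \<in> J \<Longrightarrow> spin_mean \<sigma> \<in> C"
  obtains m where "\<And>i. i < n \<Longrightarrow> \<bar>m i\<bar> \<le> 1" "(\<Sum>i<n. m i) / n \<in> C"
    "ln (\<Sum>\<sigma>\<in>J. ising_weight A \<beta> B \<sigma>)
      \<le> mean_field A \<beta> B m + l * ln 2 + \<beta> / 2 * (frobenius_norm A * (n / sqrt l))"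
proof -
  have dim: "dim_row A = n" "dim_col A = n" using A by auto
  define w where "w = ising_weight A \<beta> B"
  have wpos: "w \<sigma> > 0" for \<sigma> by (simp add: w_def ising_weight_def)
  have fJ: "finite J" using J(1) finite_spins finite_subset by blast
  have X: "\<sigma> $ i \<in> {-1, 1}" if "\<sigma> \<in> J" "i < n" for \<sigma> i using J that by (auto simp: spins_def)
  obtain P where P: "P \<subseteq> J" "P \<noteq> {}" and lnP: "ln (sum w J) \<le> ln (sum w P) + l * ln 2"
    and cov: "\<And>j. j < n \<Longrightarrow> (\<Sum>i<n. (wmean w P (\<lambda>\<sigma>. \<sigma> $ i * \<sigma> $ j)
        - wmean w P (\<lambda>\<sigma>. \<sigma> $ i) * wmean w P (\<lambda>\<sigma>. \<sigma> $ j))\<^sup>2) \<le> n / l"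
    by (rule low_covariance_subset[OF fJ J(2) _ _ l n, of w "\<lambda>i \<sigma>. \<sigma> $ i"])
      (use X in \<open>assumption | simp add: wpos\<close>)+
  have fP: "finite P" and PS: "P \<subseteq> spins n" using P J fJ finite_subset by auto
  define Z where "Z = sum w P"
  have Z: "Z > 0" unfolding Z_def using fP P wpos by (intro sum_pos) auto
  define q where "q \<sigma> = w \<sigma> / Z" for \<sigma>
  have qpos: "q \<sigma> > 0" for \<sigma> using wpos Z by (simp add: q_def)
  have sumq: "sum q P = 1" unfolding q_def sum_divide_distrib[symmetric] using Z by (simp add: Z_def)
  have wq: "wmean w P f = (\<Sum>\<sigma>\<in>P. q \<sigma> * f \<sigma>)" for f
    by (simp add: wmean_def q_def Z_def sum_divide_distrib)
  define m where "m i = wmean w P (\<lambda>\<sigma>. \<sigma> $ i)" for i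
  define c where "c i j = wmean w P (\<lambda>\<sigma>. \<sigma> $ i * \<sigma> $ j) - m i * m j" for i j
  have m1: "\<bar>m i\<bar> \<le> 1" if "i < n" for i
    unfolding m_def using that P X by (intro wmean_abs_le_one[OF fP P(2) wpos]) auto
  have "(\<Sum>\<sigma>\<in>P. q \<sigma> *\<^sub>R spin_mean \<sigma>) \<in> C"
    using P C(2) qpos by (intro convex_sum[OF fP C(1) sumq]) (auto simp: less_imp_le)
  also have "(\<Sum>\<sigma>\<in>P. q \<sigma> *\<^sub>R spin_mean \<sigma>) = (\<Sum>\<sigma>\<in>P. \<Sum>i<n. q \<sigma> * \<sigma> $ i / n)"
  proof (rule sum.cong[OF refl])
    fix \<sigma> assume "\<sigma> \<in> P"
    then have "dim_vec \<sigma> = n" using PS by (auto simp: spins_def)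
    then show "q \<sigma> *\<^sub>R spin_mean \<sigma> = (\<Sum>i<n. q \<sigma> * \<sigma> $ i / n)"
      by (simp add: spin_mean_def sum_distrib_left sum_divide_distrib)
  qed
  also have "\<dots> = (\<Sum>i<n. \<Sum>\<sigma>\<in>P. q \<sigma> * \<sigma> $ i / n)" by (rule sum.swap)
  also have "\<dots> = (\<Sum>i<n. m i) / n" by (simp add: m_def wq sum_divide_distrib)
  finally have mC: "(\<Sum>i<n. m i) / n \<in> C" .
  \<comment> \<open>Some \<open>m i\<close> may equal 1 or -1, yet the product measure charges every
    configuration of \<open>P\<close>: in the average defining \<open>1 + m i * \<sigma> $ i\<close>
    the configuration \<open>\<sigma>\<close> itself contributes a positive term and no other term
    is negative.\<close>
  have fpos: "0 < 1 + m i * \<sigma> $ i" if "\<sigma> \<in> P" "i < n" for \<sigma> i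
  proof -
    have "0 < q \<sigma> * (1 + \<sigma> $ i * \<sigma> $ i)"
      using qpos[of \<sigma>] by (intro mult_pos_pos) (auto simp: add_pos_nonneg)
    also have "\<dots> \<le> (\<Sum>\<tau>\<in>P. q \<tau> * (1 + \<tau> $ i * \<sigma> $ i))"
    proof (rule member_le_sum[OF that(1) _ fP])
      fix \<tau> assume "\<tau> \<in> P - {\<sigma>}"
      then have "\<tau> $ i \<in> {-1, 1}" "\<sigma> $ i \<in> {-1, 1}" using P X that by auto
      then show "0 \<le> q \<tau> * (1 + \<tau> $ i * \<sigma> $ i)"
        using qpos[of \<tau>] by (intro mult_nonneg_nonneg) auto
    qed
    also have "\<dots> = 1 + m i * \<sigma> $ i"
      unfolding m_def wq distrib_left sum.distrib sum_distrib_right by (simp add: sumq mult_ac)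
    finally show ?thesis .
  qed
  have "- (\<Sum>i<n. binary_entropy (m i)) = (\<Sum>\<sigma>\<in>P. q \<sigma> * ln (spin_product n m \<sigma>))"
    by (rule sum_ln_spin_product[OF PS sumq, symmetric]) (use fpos in \<open>auto simp: m_def wq\<close>)
  also have "\<dots> \<le> (\<Sum>\<sigma>\<in>P. q \<sigma> * ln (q \<sigma>))"
  proof (rule gibbs_inequality)
    show sp: "spin_product n m \<sigma> > 0" if "\<sigma> \<in> P" for \<sigma>
      unfolding spin_product_def using fpos[OF that] by (intro prod_pos) auto
    have nn: "spin_product n m \<sigma> \<ge> 0" if "\<sigma> \<in> spins n" for \<sigma>
      unfolding spin_product_def
    proof (rule prod_nonneg)
      fix k assume "k \<in> {..<n}"
      then have "\<sigma> $ k \<in> {-1, 1}" "\<bar>m k\<bar> \<le> 1" using that m1 by (auto simp: spins_def)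
      then show "0 \<le> (1 + m k * \<sigma> $ k) / 2" by auto
    qed
    \<comment> \<open>Outside \<open>P\<close> the factors may vanish but are never negative, so
      restricting to \<open>P\<close> leaves mass at most 1.\<close>
    have "sum (spin_product n m) P \<le> sum (spin_product n m) (spins n)"
      by (rule sum_mono2[OF finite_spins PS]) (use nn in auto)
    then show "sum (spin_product n m) P \<le> sum q P" by (simp add: sumq sum_spin_product)
  qed (use qpos in auto)
  \<comment> \<open>\<open>q\<close> is the Gibbs measure on \<open>P\<close>, for which the
    variational principle holds with equality.\<close>
  also have "\<dots> = (\<Sum>\<sigma>\<in>P. q \<sigma> * ln (w \<sigma>)) - ln Z"
  proof -
    have "(\<Sum>\<sigma>\<in>P. q \<sigma> * ln (q \<sigma>)) = (\<Sum>\<sigma>\<in>P. q \<sigma> * ln (w \<sigma>) - q \<sigma> * ln Z)"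
    proof (rule sum.cong[OF refl])
      fix \<sigma>
      have "ln (q \<sigma>) = ln (w \<sigma>) - ln Z" unfolding q_def using wpos[of \<sigma>] Z by (rule ln_divide_pos)
      then show "q \<sigma> * ln (q \<sigma>) = q \<sigma> * ln (w \<sigma>) - q \<sigma> * ln Z" by (simp add: right_diff_distrib)
    qed
    then show ?thesis by (simp add: sum_subtractf sum_distrib_right[symmetric] sumq)
  qed
  finally have lnZ: "ln Z \<le> (\<Sum>\<sigma>\<in>P. q \<sigma> * ln (w \<sigma>)) + (\<Sum>i<n. binary_entropy (m i))" by simp
  have "(\<Sum>\<sigma>\<in>P. q \<sigma> * ln (w \<sigma>))
      = \<beta> / 2 * (\<Sum>i<n. \<Sum>j<n. A $$ (i, j) * (m i * m j + c i j)) + B * (\<Sum>i<n. m i)"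
    unfolding w_def sum_ln_ising_weight[OF A PS] by (simp add: c_def m_def wq)
  also have "\<dots> = \<beta> / 2 * (\<Sum>i<n. \<Sum>j<n. A $$ (i, j) * (m i * m j)) + B * (\<Sum>i<n. m i)
      + \<beta> / 2 * (\<Sum>i<n. \<Sum>j<n. A $$ (i, j) * c i j)"
    by (simp add: sum.distrib algebra_simps)
  finally have E: "(\<Sum>\<sigma>\<in>P. q \<sigma> * ln (w \<sigma>)) + (\<Sum>i<n. binary_entropy (m i))
      = mean_field A \<beta> B m + \<beta> / 2 * (\<Sum>i<n. \<Sum>j<n. A $$ (i, j) * c i j)"
    by (simp add: mean_field_def dim)
  have "(\<Sum>i<n. \<Sum>j<n. A $$ (i, j) * c i j) \<le> frobenius_norm A * (n / sqrt l)"
  proof -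
    \<comment> \<open>Pinning controls the covariances with one fixed spin; summing over that spin
      gives the second factor in Cauchy-Schwarz over all index pairs.\<close>
    have cc: "(\<Sum>i<n. \<Sum>j<n. (c i j)\<^sup>2) \<le> n * (n / l)"
    proof -
      have "(\<Sum>j<n. \<Sum>i<n. (c i j)\<^sup>2) \<le> (\<Sum>j<n. n / l)"
        using cov by (intro sum_mono) (auto simp: c_def m_def)
      then show ?thesis by (subst sum.swap) simp
    qed
    have "(\<Sum>i<n. \<Sum>j<n. A $$ (i, j) * c i j)\<^sup>2
        = (\<Sum>x\<in>{..<n} \<times> {..<n}. A $$ x * c (fst x) (snd x))\<^sup>2"
      by (simp add: sum.cartesian_product case_prod_beta)
    also have "\<dots> \<le> (\<Sum>x\<in>{..<n} \<times> {..<n}. (A $$ x)\<^sup>2) * (\<Sum>x\<in>{..<n} \<times> {..<n}. (c (fst x) (snd x))\<^sup>2)"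
      by (rule Cauchy_Schwarz_ineq_sum)
    also have "\<dots> = (\<Sum>i<n. \<Sum>j<n. (A $$ (i, j))\<^sup>2) * (\<Sum>i<n. \<Sum>j<n. (c i j)\<^sup>2)"
      by (simp add: sum.cartesian_product case_prod_beta)
    also have "\<dots> \<le> (\<Sum>i<n. \<Sum>j<n. (A $$ (i, j))\<^sup>2) * (n * (n / l))"
      by (intro mult_left_mono cc sum_nonneg) auto
    also have "\<dots> = (frobenius_norm A * (n / sqrt l))\<^sup>2"
      using l unfolding frobenius_norm_def dim
      by (simp add: power_mult_distrib power_divide sum_nonneg) (simp add: power2_eq_square)
    finally show ?thesis
      by (rule power2_le_imp_le) (use l in \<open>auto simp: frobenius_norm_def intro!: divide_nonneg_nonneg mult_nonneg_nonneg sum_nonneg\<close>)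
  qed
  then have "\<beta> / 2 * (\<Sum>i<n. \<Sum>j<n. A $$ (i, j) * c i j)
      \<le> \<beta> / 2 * (frobenius_norm A * (n / sqrt l))"
    using \<beta> by (intro mult_left_mono) auto
  then have "ln (sum w J) \<le> mean_field A \<beta> B m + l * ln 2 + \<beta> / 2 * (frobenius_norm A * (n / sqrt l))"
    using lnP lnZ E unfolding Z_def by linarith
  then show thesis using that m1 mC unfolding w_def by blast
qed

section \<open>The scalar free energy\<close>

definition free_energy :: "real \<Rightarrow> real \<Rightarrow> real \<Rightarrow> real" where
  "free_energy \<beta> B x = \<beta> / 2 * x\<^sup>2 + B * x + binary_entropy x"

text \<open>Only 0 is delicate: the value there is 0, which agrees with the limit from the
  right.\<close>

lemma continuous_on_x_ln_x: "continuous_on {0..1} (\<lambda>x::real. x * ln x)"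
proof (rule continuous_on_eq_continuous_within[THEN iffD2], rule ballI)
  fix x :: real assume x: "x \<in> {0..1}"
  show "continuous (at x within {0..1}) (\<lambda>x. x * ln x)"
  proof (cases "x = 0")
    case True
    have "((\<lambda>x::real. x * ln x) \<longlongrightarrow> 0) (at_right 0)" by real_asymp
    then show ?thesis
      using True by (simp add: continuous_within at_within_Icc_at_right)
  next
    case False
    then show ?thesis using x by (intro continuous_intros) auto
  qed
qed

lemma continuous_on_free_energy: "continuous_on {-1..1} (free_energy \<beta> B)"
proof -
  have 1: "continuous_on {-1..1} (\<lambda>x::real. (1 + x) / 2 * ln ((1 + x) / 2))"
    by (rule continuous_on_compose2[OF continuous_on_x_ln_x, of _ "\<lambda>x. (1 + x) / 2"])
      (auto intro!: continuous_intros)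
  have 2: "continuous_on {-1..1} (\<lambda>x::real. (1 - x) / 2 * ln ((1 - x) / 2))"
    by (rule continuous_on_compose2[OF continuous_on_x_ln_x, of _ "\<lambda>x. (1 - x) / 2"])
      (auto intro!: continuous_intros)
  have "continuous_on {-1..1} binary_entropy"
    unfolding binary_entropy_def[abs_def] by (intro continuous_on_minus continuous_on_add 1 2)
  then have "continuous_on {-1..1} (\<lambda>x. \<beta> / 2 * x\<^sup>2 + B * x + binary_entropy x)"
    by (intro continuous_intros)
  then show ?thesis unfolding free_energy_def[abs_def] .
qed

lemma tanh_artanh_real:
  fixes x :: real
  assumes "\<bar>x\<bar> < 1"
  shows "tanh (artanh x) = x"
proof -
  have x: "0 < 1 + x" "0 < 1 - x" using assms by auto
  have "- 2 * artanh x = ln ((1 - x) / (1 + x))"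
    using x unfolding artanh_def by (simp add: ln_divide_pos)
  then have "exp (- 2 * artanh x) = (1 - x) / (1 + x)" using x by simp
  then show ?thesis unfolding tanh_real_altdef using x by (simp only:) (simp add: field_simps)
qed

text \<open>The entropy has derivative \<open>- artanh x\<close>, so the interior critical points
  are the solutions of \<open>x = tanh (\<beta> * x + B)\<close>.\<close>

lemma DERIV_free_energy:
  assumes "\<bar>x\<bar> < 1"
  shows "(free_energy \<beta> B has_real_derivative \<beta> * x + B - artanh x) (at x)"
proof -
  have x: "0 < 1 + x" "0 < 1 - x" using assms by auto
  have "((\<lambda>x. (1 + x) / 2 * ln ((1 + x) / 2)) has_real_derivative ln ((1 + x) / 2) / 2 + 1 / 2) (at x)"
    using x by (auto intro!: derivative_eq_intros simp: field_simps)
  moreover have "((\<lambda>x. (1 - x) / 2 * ln ((1 - x) / 2)) has_real_derivative - ln ((1 - x) / 2) / 2 - 1 / 2) (at x)"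
    using x by (auto intro!: derivative_eq_intros simp: field_simps)
  ultimately have "(binary_entropy has_real_derivative
      - ((ln ((1 + x) / 2) / 2 + 1 / 2) + (- ln ((1 - x) / 2) / 2 - 1 / 2))) (at x)"
    unfolding binary_entropy_def[abs_def] by (intro DERIV_minus DERIV_add)
  also have "- ((ln ((1 + x) / 2) / 2 + 1 / 2) + (- ln ((1 - x) / 2) / 2 - 1 / 2)) = - artanh x"
    using x unfolding artanh_def by (simp add: ln_divide_pos field_simps)
  finally have "(binary_entropy has_real_derivative - artanh x) (at x)" .
  then have "((\<lambda>x. \<beta> / 2 * x\<^sup>2 + B * x + binary_entropy x)
      has_real_derivative \<beta> * x + B + - artanh x) (at x)"
    by (auto intro!: derivative_eq_intros)
  then show ?thesis unfolding free_energy_def[abs_def] by simp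
qed

section \<open>Maximizers of the free energy and the mean-field equation\<close>

lemma binary_entropy_minus: "binary_entropy (- x) = binary_entropy x"
  by (simp add: binary_entropy_def)

lemma free_energy_minus: "free_energy \<beta> B (- x) = free_energy \<beta> (- B) x"
  by (simp add: free_energy_def binary_entropy_minus)

lemma free_energy_max_lt_one:
  assumes \<beta>: "\<beta> > 0"
  shows "\<exists>y\<in>{-1..1}. free_energy \<beta> B 1 < free_energy \<beta> B y"
proof -
  \<comment> \<open>To the right of \<open>tanh (\<beta> + \<bar>B\<bar>)\<close> the value
    \<open>artanh x\<close> exceeds \<open>\<beta> + \<bar>B\<bar>\<close>, hence also
    \<open>\<beta> * x + B\<close>: near 1 the diverging slope of the entropy wins and the free
    energy decreases.\<close>
  define a where "a = max 0 (tanh (\<beta> + \<bar>B\<bar>))"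
  have a: "0 \<le> a" "a < 1" by (auto simp: a_def tanh_real_lt_1)
  have "free_energy \<beta> B a > free_energy \<beta> B 1"
  proof (rule DERIV_neg_imp_decreasing_open[OF a(2)])
    fix x assume x: "a < x" "x < 1"
    have "\<beta> + \<bar>B\<bar> < artanh x"
    proof -
      have "tanh (\<beta> + \<bar>B\<bar>) < tanh (artanh x)"
        using x a by (subst tanh_artanh_real) (auto simp: a_def)
      then show ?thesis by (simp add: tanh_real_less_iff)
    qed
    moreover have "\<beta> * x \<le> \<beta>" using \<beta> x by simp
    ultimately have "\<beta> * x + B - artanh x < 0" by linarith
    moreover have "\<bar>x\<bar> < 1" using x a by auto
    ultimately show "\<exists>y. (free_energy \<beta> B has_real_derivative y) (at x) \<and> y < 0"
      using DERIV_free_energy by blast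
  next
    show "continuous_on {a..1} (free_energy \<beta> B)"
      by (rule continuous_on_subset[OF continuous_on_free_energy]) (use a in auto)
  qed
  then show ?thesis using a by (intro bexI[of _ a]) auto
qed

text \<open>The endpoint 1 is excluded by the entropy slope and -1 by reflection, which flips the
  sign of the field. The maximum is thus interior and the derivative vanishes there.\<close>

lemma free_energy_maximizer:
  assumes \<beta>: "\<beta> > 0" and x: "x \<in> {-1..1}"
    and max: "\<And>y. y \<in> {-1..1} \<Longrightarrow> free_energy \<beta> B y \<le> free_energy \<beta> B x"
  shows "\<bar>x\<bar> < 1" "x = tanh (\<beta> * x + B)"
proof -
  have "x \<noteq> 1" using free_energy_max_lt_one[OF \<beta>, of B] max by force
  moreover have "x \<noteq> -1"
  proof
    assume "x = -1"
    obtain y where "y \<in> {-1..1}" "free_energy \<beta> (- B) 1 < free_energy \<beta> (- B) y"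
      using free_energy_max_lt_one[OF \<beta>] by blast
    then show False using max[of "- y"] \<open>x = -1\<close> free_energy_minus[of \<beta> B 1]
      by (simp add: free_energy_minus)
  qed
  ultimately show x1: "\<bar>x\<bar> < 1" using x by auto
  have "\<beta> * x + B - artanh x = 0"
  proof (rule DERIV_local_max[OF DERIV_free_energy[OF x1], of "1 - \<bar>x\<bar>"])
    show "\<forall>y. \<bar>x - y\<bar> < 1 - \<bar>x\<bar> \<longrightarrow> free_energy \<beta> B y \<le> free_energy \<beta> B x"
    proof (intro allI impI)
      fix y assume "\<bar>x - y\<bar> < 1 - \<bar>x\<bar>"
      then have "y \<in> {-1..1}" by (simp add: abs_if split: if_splits)
      then show "free_energy \<beta> B y \<le> free_energy \<beta> B x" by (rule max)
    qed
  qed (use x1 in simp)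
  then show "x = tanh (\<beta> * x + B)" using tanh_artanh_real[of x] x1 by simp
qed

text \<open>\<open>f z = artanh z - \<beta> * z - B\<close> is strictly convex on [0, 1) with
  \<open>f 0 \<le> 0\<close>. If it had two zeros \<open>x < y\<close>, its mean slope would be
  nonnegative on [0, \<open>x\<close>] and zero on [\<open>x\<close>, \<open>y\<close>], against the
  strict increase of the derivative.\<close>

lemma positive_mean_field_solution_unique:
  fixes \<beta> B x y :: real
  assumes B: "B \<ge> 0" and x: "0 < x" "x = tanh (\<beta> * x + B)" and y: "0 < y" "y = tanh (\<beta> * y + B)"
  shows "x = y"
proof -
  define f where "f z = artanh z - \<beta> * z - B" for z :: real
  have root: "f z = 0" if "z = tanh (\<beta> * z + B)" for z
    using artanh_tanh_real[of "\<beta> * z + B"] that by (simp add: f_def)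
  have df: "(f has_real_derivative (1 / (1 - z\<^sup>2) - \<beta>)) (at z)" if "0 \<le> z" "z < 1" for z
    unfolding f_def[abs_def] using that
    by (auto intro!: derivative_eq_intros)
  have False if xy: "0 < x" "x < y" "y < 1" "f x = 0" "f y = 0" for x y
  proof -
    obtain u where u: "0 < u" "u < x" "f x - f 0 = (x - 0) * (1 / (1 - u\<^sup>2) - \<beta>)"
      using MVT2[of 0 x f "\<lambda>z. 1 / (1 - z\<^sup>2) - \<beta>"] df xy by auto
    obtain v where v: "x < v" "v < y" "f y - f x = (y - x) * (1 / (1 - v\<^sup>2) - \<beta>)"
      using MVT2[of x y f "\<lambda>z. 1 / (1 - z\<^sup>2) - \<beta>"] df xy by auto
    have "f 0 \<le> 0" using B by (simp add: f_def)
    then have "x * (1 / (1 - u\<^sup>2) - \<beta>) \<ge> 0" using u(3) xy by simp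
    then have "1 / (1 - u\<^sup>2) - \<beta> \<ge> 0" using xy by (simp add: zero_le_mult_iff)
    moreover have "1 / (1 - v\<^sup>2) - \<beta> = 0" using v(3) xy by simp
    moreover have "1 / (1 - u\<^sup>2) < 1 / (1 - v\<^sup>2)"
    proof (rule divide_strict_left_mono)
      have "u\<^sup>2 < v\<^sup>2" using u v xy by (intro power_strict_mono) auto
      moreover have "v\<^sup>2 < 1" using v xy u by (simp add: power_less_one_iff)
      ultimately show "1 - v\<^sup>2 < 1 - u\<^sup>2" "0 < (1 - u\<^sup>2) * (1 - v\<^sup>2)" by auto
    qed simp
    ultimately show False by simp
  qed
  moreover have "x < 1" "y < 1" using x(2) y(2) tanh_real_lt_1 by metis+
  ultimately show ?thesis using root[OF x(2)] root[OF y(2)] x y by (metis linorder_neqE)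
qed

lemma free_energy_attains_max:
  "\<exists>x\<in>{-1..1}. \<forall>y\<in>{-1..1}. free_energy \<beta> B y \<le> free_energy \<beta> B x"
  by (rule continuous_attains_sup[OF _ _ continuous_on_free_energy]) auto

text \<open>Reflecting a negative point strictly gains field energy, and 0 does not solve the
  mean-field equation when \<open>B > 0\<close>. Every maximizer is therefore a positive solution,
  of which there is only one.\<close>

lemma free_energy_unique_max_field:
  assumes \<beta>: "\<beta> > 0" and B: "B > 0"
  obtains t where "0 < t" "t < 1" "t = tanh (\<beta> * t + B)"
    "\<And>x. x \<in> {-1..1} \<Longrightarrow> x \<noteq> t \<Longrightarrow> free_energy \<beta> B x < free_energy \<beta> B t"
proof -
  have pos: "0 < x" if x: "x \<in> {-1..1}"
    and max: "\<And>y. y \<in> {-1..1} \<Longrightarrow> free_energy \<beta> B y \<le> free_energy \<beta> B x" for x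
  proof (rule ccontr)
    assume "\<not> 0 < x"
    moreover have "x \<noteq> 0" using free_energy_maximizer(2)[OF \<beta> x max] B by auto
    ultimately have "x < 0" by simp
    then have "B * x < 0" using B by (simp add: mult_pos_neg)
    then have "free_energy \<beta> B x < free_energy \<beta> B (- x)"
      by (simp add: free_energy_minus) (simp add: free_energy_def)
    then show False using max[of "- x"] x by auto
  qed
  obtain t where t: "t \<in> {-1..1}" "\<And>y. y \<in> {-1..1} \<Longrightarrow> free_energy \<beta> B y \<le> free_energy \<beta> B t"
    using free_energy_attains_max by blast
  note mt = free_energy_maximizer[OF \<beta> t]
  show thesis
  proof (rule that[of t])
    fix x :: real assume x: "x \<in> {-1..1}" "x \<noteq> t"
    show "free_energy \<beta> B x < free_energy \<beta> B t"
    proof (rule ccontr)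
      assume "\<not> ?thesis"
      then have max: "free_energy \<beta> B y \<le> free_energy \<beta> B x" if "y \<in> {-1..1}" for y
        using t(2)[OF that] by simp
      have "x = t"
        by (rule positive_mean_field_solution_unique[OF less_imp_le[OF B]
              pos[OF x(1) max] free_energy_maximizer(2)[OF \<beta> x(1) max] pos[OF t] mt(2)])
      then show False using x(2) by simp
    qed
  qed (use pos[OF t] mt in auto)
qed

text \<open>The definite description in \<open>magnetization\<close> is identified with the
  maximizer; the reflection of \<open>x\<close> handles the opposite field.\<close>

lemma magnetization_field_pos:
  assumes \<beta>: "\<beta> > 0" and B: "B > 0"
  shows "0 < magnetization \<beta> B" "magnetization \<beta> B < 1"
    "\<And>x. x \<in> {-1..1} \<Longrightarrow> x \<noteq> magnetization \<beta> B \<Longrightarrow>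
      free_energy \<beta> B x < free_energy \<beta> B (magnetization \<beta> B)"
    "magnetization \<beta> (- B) = - magnetization \<beta> B"
proof -
  obtain t where t: "0 < t" "t < 1" "t = tanh (\<beta> * t + B)"
    "\<And>x. x \<in> {-1..1} \<Longrightarrow> x \<noteq> t \<Longrightarrow> free_energy \<beta> B x < free_energy \<beta> B t"
    using free_energy_unique_max_field[OF \<beta> B] by blast
  have un: "x = t" if "0 < x" "x = tanh (\<beta> * x + B)" for x
    using positive_mean_field_solution_unique[of B x \<beta> t] that t B by auto
  have sgn_pos: "sgn x = sgn B \<longleftrightarrow> 0 < x" for x using B by (auto simp: sgn_if split: if_splits)
  have sgn_neg: "sgn x = sgn (- B) \<longleftrightarrow> x < 0" for x using B by (auto simp: sgn_if split: if_splits)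
  have "(THE x. x = tanh (\<beta> * x + B) \<and> sgn x = sgn B) = t"
    unfolding sgn_pos by (rule the_equality) (use t(1,3) un in blast)+
  then have m: "magnetization \<beta> B = t" using \<beta> B by (simp add: magnetization_def Theta12_def)
  have "(THE x. x = tanh (\<beta> * x + - B) \<and> sgn x = sgn (- B)) = - t"
    unfolding sgn_neg
  proof (rule the_equality)
    have "tanh (\<beta> * - t + - B) = - tanh (\<beta> * t + B)"
      using tanh_minus[of "\<beta> * t + B"] by simp
    then show "- t = tanh (\<beta> * - t + - B) \<and> - t < 0" using t by simp
  next
    fix x assume x: "x = tanh (\<beta> * x + - B) \<and> x < 0"
    have "- x = tanh (\<beta> * - x + B)"
      using tanh_minus[of "\<beta> * x + - B"] x by simp
    moreover have "0 < - x" using x by simp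
    ultimately have "- x = t" using un by blast
    then show "x = - t" by simp
  qed
  then have m': "magnetization \<beta> (- B) = - t" using \<beta> B by (simp add: magnetization_def Theta12_def)
  show "0 < magnetization \<beta> B" "magnetization \<beta> B < 1" using t m by auto
  show "\<And>x. x \<in> {-1..1} \<Longrightarrow> x \<noteq> magnetization \<beta> B \<Longrightarrow>
      free_energy \<beta> B x < free_energy \<beta> B (magnetization \<beta> B)" using t(4) m by auto
  show "magnetization \<beta> (- B) = - magnetization \<beta> B" using m m' by simp
qed

lemma magnetization_unique_max:
  assumes "(\<beta>, B) \<in> Theta1 \<union> Theta3"
  shows "\<bar>magnetization \<beta> B\<bar> < 1 \<and> (\<forall>x\<in>{-1..1}. x \<noteq> magnetization \<beta> B \<longrightarrow>
      free_energy \<beta> B x < free_energy \<beta> B (magnetization \<beta> B))"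
proof -
  have \<beta>: "\<beta> > 0"
    using assms by (auto simp: Theta1_def Theta11_def Theta12_def Theta3_def)
  consider "B > 0" | "B < 0" | "B = 0" "\<beta> \<le> 1"
    using assms by (fastforce simp: Theta1_def Theta11_def Theta12_def Theta3_def)
  then show ?thesis
  proof cases
    case 1
    then show ?thesis using magnetization_field_pos[OF \<beta> 1] by auto
  next
    case 2
    define t where "t = magnetization \<beta> (- B)"
    have m: "0 < t" "t < 1" "magnetization \<beta> B = - t"
      "\<And>x. x \<in> {-1..1} \<Longrightarrow> x \<noteq> t \<Longrightarrow> free_energy \<beta> (- B) x < free_energy \<beta> (- B) t"
      using magnetization_field_pos[OF \<beta>, of "- B"] 2 by (auto simp: t_def)
    have "free_energy \<beta> B x < free_energy \<beta> B (- t)" if "x \<in> {-1..1}" "x \<noteq> - t" for x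
      using m(4)[of "- x"] that by (auto simp: free_energy_minus)
    then show ?thesis using m by auto
  next
    case 3
    have m: "magnetization \<beta> B = 0"
      using 3 by (auto simp: magnetization_def Theta12_def Theta2_def)
    \<comment> \<open>For \<open>\<beta> \<le> 1\<close> the function
      \<open>artanh z - \<beta> * z\<close> vanishes at 0 and increases strictly to the right, since
      its slope \<open>1 / (1 - z\<^sup>2) - \<beta>\<close> is positive for \<open>z > 0\<close>
      even at \<open>\<beta> = 1\<close>.\<close>
    have nopos: False if x: "0 < x" "x = tanh (\<beta> * x)" for x
    proof -
      have x1: "x < 1" using x(2) tanh_real_lt_1 by metis
      have root: "artanh x - \<beta> * x = 0" using artanh_tanh_real[of "\<beta> * x"] x by simp
      have "artanh 0 - \<beta> * 0 < artanh x - \<beta> * x"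
      proof (rule DERIV_pos_imp_increasing_open[OF x(1)])
        fix z assume z: "0 < z" "z < x"
        have z2: "z\<^sup>2 < 1" "0 < z\<^sup>2" using z x1 by (auto simp: power_less_one_iff)
        have "1 < 1 / (1 - z\<^sup>2)" using z2 by simp
        then have "0 < 1 / (1 - z\<^sup>2) - \<beta>" using 3 by linarith
        moreover have "((\<lambda>z. artanh z - \<beta> * z) has_real_derivative 1 / (1 - z\<^sup>2) - \<beta>) (at z)"
          using z x1 by (auto intro!: derivative_eq_intros)
        ultimately show "\<exists>y. ((\<lambda>z. artanh z - \<beta> * z) has_real_derivative y) (at z) \<and> 0 < y" by blast
      next
        show "continuous_on {0..x} (\<lambda>z. artanh z - \<beta> * z)"
          using x1 by (intro continuous_intros) auto
      qed
      then show False using root by simp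
    qed
    have zero: "x = 0" if x: "x = tanh (\<beta> * x)" for x
    proof (rule linorder_cases[of x 0])
      assume "x < 0"
      moreover have "- x = tanh (\<beta> * - x)" using tanh_minus[of "\<beta> * x"] x by simp
      ultimately show ?thesis using nopos[of "- x"] by simp
    qed (use nopos x in auto)
    obtain t where t: "t \<in> {-1..1}" "\<And>y. y \<in> {-1..1} \<Longrightarrow> free_energy \<beta> B y \<le> free_energy \<beta> B t"
      using free_energy_attains_max by blast
    have "t = 0" using zero free_energy_maximizer(2)[OF \<beta> t] 3 by simp
    have "free_energy \<beta> B x < free_energy \<beta> B 0" if x: "x \<in> {-1..1}" "x \<noteq> 0" for x
    proof (rule ccontr)
      assume "\<not> ?thesis"
      then have "free_energy \<beta> B y \<le> free_energy \<beta> B x" if "y \<in> {-1..1}" for y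
        using t(2)[OF that] \<open>t = 0\<close> by simp
      from free_energy_maximizer(2)[OF \<beta> x(1) this] have "x = tanh (\<beta> * x)" using 3 by simp
      then show False using zero x(2) by blast
    qed
    then show ?thesis by (simp add: m)
  qed
qed

lemma magnetization_double_well:
  assumes "\<beta> > 1"
  shows "0 < magnetization \<beta> 0" "magnetization \<beta> 0 < 1"
    "\<And>x. x \<in> {-1..1} \<Longrightarrow> \<bar>x\<bar> \<noteq> magnetization \<beta> 0 \<Longrightarrow>
      free_energy \<beta> 0 x < free_energy \<beta> 0 (magnetization \<beta> 0)"
proof -
  have \<beta>: "\<beta> > 0" using assms by simp
  have abs: "free_energy \<beta> 0 \<bar>x\<bar> = free_energy \<beta> 0 x" for x
    by (cases "x \<ge> 0") (auto simp: free_energy_minus)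
  \<comment> \<open>The derivative \<open>g\<close> of the free energy vanishes at 0 with slope
    \<open>\<beta> - 1 > 0\<close>, so the free energy rises to the right of 0. This removes the
    solution 0 of the mean-field equation from the candidates; evenness reduces the others to
    positive solutions.\<close>
  have "\<exists>y\<in>{-1..1}. free_energy \<beta> 0 0 < free_energy \<beta> 0 y"
  proof -
    define g where "g z = \<beta> * z + 0 - artanh z" for z :: real
    have "(g has_real_derivative \<beta> - 1) (at 0)"
      unfolding g_def[abs_def] by (auto intro!: derivative_eq_intros)
    from DERIV_pos_inc_right[OF this] obtain d where d: "d > 0"
      "\<And>h. 0 < h \<Longrightarrow> h < d \<Longrightarrow> g 0 < g (0 + h)" using assms by auto
    define y where "y = min d 1 / 2"
    have y: "0 < y" "y < d" "y < 1" using d by (auto simp: y_def min_def)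
    have "free_energy \<beta> 0 0 < free_energy \<beta> 0 y"
    proof (rule DERIV_pos_imp_increasing_open[OF y(1)])
      fix x assume x: "0 < x" "x < y"
      then have "0 < g x" using d(2)[of x] y by (simp add: g_def)
      moreover have "(free_energy \<beta> 0 has_real_derivative g x) (at x)"
        unfolding g_def using x y by (intro DERIV_free_energy) auto
      ultimately show "\<exists>l. (free_energy \<beta> 0 has_real_derivative l) (at x) \<and> 0 < l" by blast
    next
      show "continuous_on {0..y} (free_energy \<beta> 0)"
        by (rule continuous_on_subset[OF continuous_on_free_energy]) (use y in auto)
    qed
    then show ?thesis using y by (intro bexI[of _ y]) auto
  qed
  then obtain y0 where y0: "y0 \<in> {-1..1}" "free_energy \<beta> 0 0 < free_energy \<beta> 0 y0" by blast
  have sol: "0 < \<bar>x\<bar> \<and> \<bar>x\<bar> < 1 \<and> \<bar>x\<bar> = tanh (\<beta> * \<bar>x\<bar>)" if x: "x \<in> {-1..1}"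
    and max: "\<And>y. y \<in> {-1..1} \<Longrightarrow> free_energy \<beta> 0 y \<le> free_energy \<beta> 0 x" for x
  proof -
    have ax: "\<bar>x\<bar> \<in> {-1..1}" using x by auto
    have "x \<noteq> 0" using max[OF y0(1)] y0(2) by auto
    then show ?thesis using free_energy_maximizer[OF \<beta> ax, of 0] max by (auto simp: abs)
  qed
  have un: "x = y" if "0 < x" "x = tanh (\<beta> * x)" "0 < y" "y = tanh (\<beta> * y)" for x y
    using positive_mean_field_solution_unique[of 0 x \<beta> y] that by simp
  obtain t where t: "t \<in> {-1..1}" "\<And>y. y \<in> {-1..1} \<Longrightarrow> free_energy \<beta> 0 y \<le> free_energy \<beta> 0 t"
    using free_energy_attains_max by blast
  have solt: "0 < \<bar>t\<bar>" "\<bar>t\<bar> < 1" "\<bar>t\<bar> = tanh (\<beta> * \<bar>t\<bar>)" using sol[OF t] by auto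
  have "(THE x. 0 < x \<and> x = tanh (\<beta> * x)) = \<bar>t\<bar>"
    by (rule the_equality) (use solt un in blast)+
  then have m: "magnetization \<beta> 0 = \<bar>t\<bar>"
    using assms by (simp add: magnetization_def Theta12_def Theta2_def)
  show "0 < magnetization \<beta> 0" "magnetization \<beta> 0 < 1" using solt m by auto
  fix x :: real assume x: "x \<in> {-1..1}" "\<bar>x\<bar> \<noteq> magnetization \<beta> 0"
  show "free_energy \<beta> 0 x < free_energy \<beta> 0 (magnetization \<beta> 0)"
  proof (rule ccontr)
    assume "\<not> ?thesis"
    then have "free_energy \<beta> 0 y \<le> free_energy \<beta> 0 x" if "y \<in> {-1..1}" for y
      using t(2)[OF that] by (simp add: m abs)
    from sol[OF x(1) this] have "\<bar>x\<bar> = \<bar>t\<bar>" using un solt by blast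
    then show False using x(2) m by simp
  qed
qed

text \<open>Compactness gives a uniform loss \<open>\<eta>\<close> where
  \<open>D x \<ge> \<epsilon>\<close>; elsewhere the slack \<open>\<kappa> * \<epsilon>\<close>
  absorbs the linear term. The cap \<open>\<kappa>0\<close> lets this loss be matched with a penalty
  of given strength.\<close>

lemma linear_loss_away_from_max:
  fixes \<phi> D :: "real \<Rightarrow> real"
  assumes K: "compact K" and cont: "continuous_on K \<phi>" "continuous_on K D"
    and max: "\<And>x. x \<in> K \<Longrightarrow> \<phi> x \<le> M" "\<And>x. x \<in> K \<Longrightarrow> D x > 0 \<Longrightarrow> \<phi> x < M"
    and D: "\<And>x. x \<in> K \<Longrightarrow> D x \<le> 2" and \<epsilon>: "\<epsilon> > 0" and \<kappa>0: "\<kappa>0 > 0"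
  obtains \<kappa> where "0 < \<kappa>" "\<kappa> \<le> \<kappa>0" "\<And>x. x \<in> K \<Longrightarrow> \<phi> x \<le> M - \<kappa> * D x + \<kappa> * \<epsilon>"
proof -
  define S where "S = {x \<in> K. \<epsilon> \<le> D x}"
  have near: "\<phi> x \<le> M - \<kappa> * D x + \<kappa> * \<epsilon>" if "x \<in> K" "x \<notin> S" "\<kappa> > 0" for x \<kappa>
  proof -
    have "\<kappa> * D x \<le> \<kappa> * \<epsilon>" using that by (intro mult_left_mono) (auto simp: S_def)
    then show ?thesis using max(1)[OF that(1)] by linarith
  qed
  show thesis
  proof (cases "S = {}")
    case True
    then show thesis using that[OF \<kappa>0 order_refl] near \<kappa>0 by blast
  next
    case False
    have "S = K \<inter> D -` {\<epsilon>..}" by (auto simp: S_def)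
    then have "closedin (top_of_set K) S"
      using continuous_closedin_preimage[OF cont(2) closed_atLeast] by simp
    then have "compact S" using K by (rule closedin_compact[rotated])
    moreover have "continuous_on S \<phi>" using cont(1) by (rule continuous_on_subset) (auto simp: S_def)
    ultimately obtain x0 where x0: "x0 \<in> S" "\<And>x. x \<in> S \<Longrightarrow> \<phi> x \<le> \<phi> x0"
      using continuous_attains_sup False by metis
    define \<eta> where "\<eta> = M - \<phi> x0"
    have \<eta>: "\<eta> > 0" using max(2)[of x0] x0(1) \<epsilon> by (auto simp: S_def \<eta>_def)
    \<comment> \<open>The half comes from \<open>D x \<le> 2\<close>: then
      \<open>\<kappa> * D x\<close> never exceeds \<open>\<eta>\<close>.\<close>
    define \<kappa> where "\<kappa> = min \<kappa>0 (\<eta> / 2)"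
    have \<kappa>: "\<kappa> > 0" using \<eta> \<kappa>0 by (simp add: \<kappa>_def)
    show thesis
    proof (rule that[OF \<kappa>])
      fix x assume x: "x \<in> K"
      show "\<phi> x \<le> M - \<kappa> * D x + \<kappa> * \<epsilon>"
      proof (cases "x \<in> S")
        case True
        have "\<kappa> * D x \<le> \<kappa> * 2" using D[OF x] \<kappa> by (intro mult_left_mono) auto
        also have "\<dots> \<le> \<eta>" by (simp add: \<kappa>_def)
        finally have "\<kappa> * D x \<le> \<eta>" .
        moreover have "0 < \<kappa> * \<epsilon>" using \<kappa> \<epsilon> by simp
        ultimately show ?thesis using x0(2)[OF True] by (simp add: \<eta>_def)
      qed (use near x \<kappa> in blast)
    qed (simp add: \<kappa>_def)
  qed
qed

section \<open>Large deviations of the magnetization\<close>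

lemma quadratic_form_vec:
  fixes A :: "real mat"
  assumes "A \<in> carrier_mat n n"
  shows "(\<Sum>i<n. \<Sum>j<n. A $$ (i, j) * (m i * m j)) = vec n m \<bullet> (A *\<^sub>v vec n m)"
    "vec n m \<bullet> vec n m = (\<Sum>i<n. (m i)\<^sup>2)"
proof -
  show "(\<Sum>i<n. \<Sum>j<n. A $$ (i, j) * (m i * m j)) = vec n m \<bullet> (A *\<^sub>v vec n m)"
    using quadratic_form_sum[OF assms, of "vec n m"] by simp
  show "vec n m \<bullet> vec n m = (\<Sum>i<n. (m i)\<^sup>2)"
    by (simp add: scalar_prod_def atLeast0LessThan power2_eq_square)
qed

text \<open>Replacing \<open>A\<close> by the identity decouples the sites into scalar free
  energies; the remainder is the quadratic form of \<open>A\<close> minus the identity, which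
  spectral bounds control.\<close>

lemma mean_field_split:
  fixes A :: "real mat"
  assumes "A \<in> carrier_mat n n"
  shows "mean_field A \<beta> B m = (\<Sum>i<n. free_energy \<beta> B (m i))
    + \<beta> / 2 * ((\<Sum>i<n. \<Sum>j<n. A $$ (i, j) * (m i * m j)) - (\<Sum>i<n. (m i)\<^sup>2))"
  using assms
  by (simp add: mean_field_def free_energy_def sum.distrib sum_distrib_left right_diff_distrib)

lemma sum_squares_le_card:
  fixes m :: "nat \<Rightarrow> real"
  assumes "\<And>i. i < n \<Longrightarrow> \<bar>m i\<bar> \<le> 1"
  shows "(\<Sum>i<n. (m i)\<^sup>2) \<le> n"
proof -
  have "(\<Sum>i<n. (m i)\<^sup>2) \<le> (\<Sum>i<n. 1)" using assms by (intro sum_mono) (auto simp: abs_square_le_1)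
  then show ?thesis by simp
qed

lemma mean_field_le:
  assumes A: "coupling_matrix n A" and \<beta>: "\<beta> \<ge> 0" and m: "\<And>i. i < n \<Longrightarrow> \<bar>m i\<bar> \<le> 1"
  shows "mean_field A \<beta> B m
    \<le> (\<Sum>i<n. free_energy \<beta> B (m i)) + n * (\<beta> / 2 * \<bar>kth_eigenvalue 1 A - 1\<bar>)"
proof -
  have Ac: "A \<in> carrier_mat n n" "transpose_mat A = A" using A by (auto simp: coupling_matrix_def)
  define V where "V = (\<Sum>i<n. (m i)\<^sup>2)"
  have "(\<Sum>i<n. \<Sum>j<n. A $$ (i, j) * (m i * m j)) \<le> kth_eigenvalue 1 A * V"
    using quadratic_form_le_top[OF Ac, of "vec n m"]
    unfolding quadratic_form_vec[OF Ac(1)] V_def by simp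
  then have "(\<Sum>i<n. \<Sum>j<n. A $$ (i, j) * (m i * m j)) - V \<le> (kth_eigenvalue 1 A - 1) * V"
    by (simp add: left_diff_distrib)
  also have "\<dots> \<le> \<bar>kth_eigenvalue 1 A - 1\<bar> * n"
    using sum_squares_le_card[of n m] m by (intro mult_mono) (auto simp: V_def sum_nonneg)
  finally have "\<beta> / 2 * ((\<Sum>i<n. \<Sum>j<n. A $$ (i, j) * (m i * m j)) - V)
      \<le> \<beta> / 2 * (\<bar>kth_eigenvalue 1 A - 1\<bar> * n)" using \<beta> by (intro mult_left_mono) auto
  then show ?thesis unfolding mean_field_split[OF Ac(1)] V_def by (simp add: mult_ac)
qed

text \<open>The average row sum \<open>S\<close> is the Rayleigh quotient of the constant vector, so when it is
  close to the top eigenvalue and the spectral gap is open, the top eigenvector is nearly constant.\<close>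

lemma quadratic_form_le_mean:
  fixes A :: "real mat" and m :: "nat \<Rightarrow> real"
  assumes A: "coupling_matrix n A" and n: "n > 0" and m: "\<And>i. i < n \<Longrightarrow> \<bar>m i\<bar> \<le> 1"
    and \<mu>: "kth_eigenvalue 2 A \<le> \<mu>" "\<mu> \<le> kth_eigenvalue 1 A"
  defines "S \<equiv> (\<Sum>i<n. row_sum A i) / n"
  shows "(\<Sum>i<n. \<Sum>j<n. A $$ (i, j) * (m i * m j)) \<le> \<mu> * (\<Sum>i<n. (m i)\<^sup>2)
    + (kth_eigenvalue 1 A - \<mu>) * (n * ((\<Sum>i<n. m i) / n)\<^sup>2)
    + n * (3 * sqrt ((kth_eigenvalue 1 A - \<mu>) * (kth_eigenvalue 1 A - S)))"
proof -
  have Ac: "A \<in> carrier_mat n n" "transpose_mat A = A" using A by (auto simp: coupling_matrix_def)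
  obtain p where p: "p \<in> carrier_vec n" "p \<bullet> p = 1"
    and le: "\<And>x \<mu>. x \<in> carrier_vec n \<Longrightarrow> kth_eigenvalue 2 A \<le> \<mu> \<Longrightarrow>
       x \<bullet> (A *\<^sub>v x) \<le> \<mu> * (x \<bullet> x) + (kth_eigenvalue 1 A - \<mu>) * (p \<bullet> x)\<^sup>2"
    by (rule quadratic_form_le_gap[OF Ac n]) blast
  define \<gamma> where "\<gamma> = kth_eigenvalue 1 A - \<mu>"
  have \<gamma>: "\<gamma> \<ge> 0" using \<mu> by (simp add: \<gamma>_def)
  have pv: "p \<bullet> vec n y = (\<Sum>i<n. p $ i * y i)" for y
    by (simp add: scalar_prod_def atLeast0LessThan)
  have pp: "(\<Sum>i<n. (p $ i)\<^sup>2) = 1"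
    using p by (simp add: scalar_prod_def atLeast0LessThan power2_eq_square)
  \<comment> \<open>\<open>c\<close> is the cosine of the angle between \<open>p\<close> and the
    constant vector, and \<open>e\<close> the squared sine, that is, the squared distance from
    \<open>p\<close> to its projection on the constants.\<close>
  define c where "c = (\<Sum>i<n. p $ i) / sqrt n"
  define e where "e = 1 - c\<^sup>2"
  define mb where "mb = (\<Sum>i<n. m i) / n"
  have sn: "sqrt n > 0" "sqrt n * sqrt n = n" using n by auto
  have sp: "(\<Sum>i<n. p $ i) = c * sqrt n" using sn by (simp add: c_def)
  have e: "(\<Sum>i<n. (p $ i - c / sqrt n)\<^sup>2) = e"
  proof -
    have "(\<Sum>i<n. (p $ i - c / sqrt n)\<^sup>2)
        = (\<Sum>i<n. (p $ i)\<^sup>2 - 2 * (c / sqrt n) * p $ i + (c / sqrt n)\<^sup>2)"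
      by (intro sum.cong refl) (simp add: power2_eq_square algebra_simps)
    also have "\<dots> = 1 - 2 * (c / sqrt n) * (c * sqrt n) + n * (c / sqrt n)\<^sup>2"
      unfolding sum.distrib sum_subtractf sum_distrib_left[symmetric] pp sp by simp
    also have "\<dots> = e" using sn n by (simp add: e_def power2_eq_square field_simps)
    finally show ?thesis .
  qed
  have e0: "0 \<le> e" unfolding e[symmetric] by (intro sum_nonneg) auto
  have e1: "e \<le> 1" by (simp add: e_def)
  \<comment> \<open>Testing the gap bound on the all-ones vector limits the angle:
    \<open>S \<le> \<mu> + \<gamma> * (1 - e)\<close>.\<close>
  have "(\<Sum>i<n. row_sum A i) = (\<Sum>i<n. \<Sum>j<n. A $$ (i, j) * (1 * 1))"
    using Ac by (simp add: row_sum_def)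
  also have "\<dots> = vec n (\<lambda>_. 1) \<bullet> (A *\<^sub>v vec n (\<lambda>_. 1))"
    by (rule quadratic_form_vec(1)[OF Ac(1), of "\<lambda>_. 1"])
  also have "\<dots> \<le> \<mu> * n + \<gamma> * (c * sqrt n)\<^sup>2"
    using le[OF vec_carrier \<mu>(1), of "\<lambda>_. 1"]
    unfolding quadratic_form_vec(2)[OF Ac(1)] pv by (simp add: sp \<gamma>_def)
  also have "(c * sqrt n)\<^sup>2 = n * (1 - e)" by (simp add: e_def power_mult_distrib)
  finally have "S \<le> \<mu> + \<gamma> * (1 - e)" using n unfolding S_def by (simp add: field_simps)
  then have \<gamma>e: "\<gamma> * e \<le> kth_eigenvalue 1 A - S" by (simp add: \<gamma>_def algebra_simps)
  \<comment> \<open>Only the product with \<open>\<gamma>\<close> is bounded, which avoids dividing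
    by a gap that may be zero.\<close>
  have \<gamma>se: "\<gamma> * sqrt e \<le> sqrt (\<gamma> * (kth_eigenvalue 1 A - S))"
  proof (rule real_le_rsqrt)
    have "(\<gamma> * sqrt e)\<^sup>2 = \<gamma> * (\<gamma> * e)" using e0 by (simp add: power_mult_distrib power2_eq_square)
    also have "\<dots> \<le> \<gamma> * (kth_eigenvalue 1 A - S)" using \<gamma>e \<gamma> by (rule mult_left_mono)
    finally show "(\<gamma> * sqrt e)\<^sup>2 \<le> \<gamma> * (kth_eigenvalue 1 A - S)" .
  qed
  define r where "r = (\<Sum>i<n. (p $ i - c / sqrt n) * m i)"
  have "r\<^sup>2 \<le> e * (\<Sum>i<n. (m i)\<^sup>2)"
    unfolding r_def e[symmetric] by (rule Cauchy_Schwarz_ineq_sum)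
  also have "\<dots> \<le> e * n" using sum_squares_le_card[of n m] m e0 by (intro mult_left_mono) auto
  finally have r2: "r\<^sup>2 \<le> e * n" .
  then have r: "\<bar>r\<bar> \<le> sqrt e * sqrt n"
    by (metis real_sqrt_abs real_sqrt_le_iff real_sqrt_mult)
  have pm: "p \<bullet> vec n m = c * sqrt n * mb + r"
  proof -
    have "r = (\<Sum>i<n. p $ i * m i) - c / sqrt n * (\<Sum>i<n. m i)"
      unfolding r_def by (simp add: left_diff_distrib sum_subtractf sum_distrib_left)
    also have "(\<Sum>i<n. m i) = n * mb" using n by (simp add: mb_def)
    also have "c / sqrt n * (n * mb) = c * sqrt n * mb" using sn by (simp add: field_simps)
    finally show ?thesis by (simp add: pv)
  qed
  have mb1: "\<bar>mb\<bar> \<le> 1"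
  proof -
    have "\<bar>\<Sum>i<n. m i\<bar> \<le> (\<Sum>i<n. 1)" using m by (intro order_trans[OF sum_abs] sum_mono) auto
    then show ?thesis using n by (simp add: mb_def abs_divide)
  qed
  have c1: "\<bar>c\<bar> \<le> 1" using e0 by (simp add: e_def abs_square_le_1)
  have "(p \<bullet> vec n m)\<^sup>2 = c\<^sup>2 * (n * mb\<^sup>2) + 2 * (c * mb) * (sqrt n * r) + r\<^sup>2"
    unfolding pm using sn by (simp add: power2_eq_square algebra_simps)
  \<comment> \<open>The factor 3 of the statement: the cross term contributes
    \<open>2 * (n * sqrt e)\<close>, and the square of \<open>r\<close> contributes
    \<open>e * n\<close>, at most \<open>n * sqrt e\<close> because
    \<open>e \<le> 1\<close>.\<close>
  also have "\<dots> \<le> 1 * (n * mb\<^sup>2) + 2 * (n * sqrt e) + n * sqrt e"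
  proof (intro add_mono)
    show "c\<^sup>2 * (n * mb\<^sup>2) \<le> 1 * (n * mb\<^sup>2)"
      using c1 by (intro mult_right_mono) (auto simp: abs_square_le_1)
    have "\<bar>2 * (c * mb) * (sqrt n * r)\<bar> \<le> 2 * (1 * 1) * (sqrt n * (sqrt e * sqrt n))"
      unfolding abs_mult using c1 mb1 r sn e0 by (intro mult_mono) auto
    also have "\<dots> = 2 * (n * sqrt e)" using sn by (simp add: mult_ac)
    finally show "2 * (c * mb) * (sqrt n * r) \<le> 2 * (n * sqrt e)" by linarith
    have "e \<le> sqrt e" using e0 e1 by (metis abs_of_nonneg mult_left_le real_sqrt_ge_zero real_sqrt_le_1_iff real_sqrt_mult_self)
    then have "e * n \<le> n * sqrt e" using mult_right_mono[of e "sqrt e" n] by (simp add: mult.commute)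
    then show "r\<^sup>2 \<le> n * sqrt e" using r2 by linarith
  qed
  finally have "\<gamma> * (p \<bullet> vec n m)\<^sup>2 \<le> \<gamma> * (n * mb\<^sup>2 + 3 * (n * sqrt e))"
    using \<gamma> by (intro mult_left_mono) auto
  also have "\<dots> = \<gamma> * (n * mb\<^sup>2) + n * (3 * (\<gamma> * sqrt e))" by (simp add: algebra_simps)
  also have "\<dots> \<le> \<gamma> * (n * mb\<^sup>2) + n * (3 * sqrt (\<gamma> * (kth_eigenvalue 1 A - S)))"
    using \<gamma>se by (intro add_left_mono mult_left_mono) auto
  finally show ?thesis
    using le[OF vec_carrier \<mu>(1), of m] unfolding quadratic_form_vec[OF Ac(1)]
    unfolding \<gamma>_def[symmetric] mb_def[symmetric] by linarith
qed

text \<open>The probability is a ratio of weights: the variational upper bound is applied to the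
  numerator and the lower bound at constant mean \<open>t\<close> to the partition function. The
  energy of that constant vector differs from its scalar value through the average row sum, hence
  the last term.\<close>

lemma prob_spin_mean_le:
  assumes A: "coupling_matrix n A" and n: "n > 0" and \<beta>: "\<beta> \<ge> 0" and t: "\<bar>t\<bar> < 1" and \<epsilon>: "\<epsilon> > 0"
    and C: "convex C"
    and K: "\<And>m. (\<And>i. i < n \<Longrightarrow> \<bar>m i\<bar> \<le> 1) \<Longrightarrow> (\<Sum>i<n. m i) / n \<in> C \<Longrightarrow>
      mean_field A \<beta> B m \<le> n * K"
  shows "measure_pmf.prob (ising_pmf A \<beta> B) {\<sigma>. spin_mean \<sigma> \<in> C}
    \<le> exp (n * (K - free_energy \<beta> B t + \<epsilon> + \<beta> / 2 * (frobenius_norm A / sqrt n / sqrt \<epsilon>)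
        + \<beta> / 2 * \<bar>(\<Sum>i<n. row_sum A i) / n - 1\<bar>))" (is "_ \<le> exp (_ * ?r)")
proof -
  have Ac: "A \<in> carrier_mat n n" using A by (auto simp: coupling_matrix_def)
  then have dim: "dim_row A = n" by simp
  define J where "J = {\<sigma> \<in> spins n. spin_mean \<sigma> \<in> C}"
  let ?p = "ising_pmf A \<beta> B"
  let ?Z = "ising_Z A \<beta> B"
  have Z: "?Z > 0" by (rule ising_Z_pos)
  have fJ: "finite J" unfolding J_def using finite_spins by simp
  have "measure_pmf.prob ?p {\<sigma>. spin_mean \<sigma> \<in> C}
      = measure_pmf.prob ?p ({\<sigma>. spin_mean \<sigma> \<in> C} \<inter> set_pmf ?p)"
    by (simp add: measure_Int_set_pmf)
  also have "\<dots> \<le> measure_pmf.prob ?p J"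
    by (rule measure_pmf.finite_measure_mono)
      (auto simp: J_def set_pmf_eq pmf_ising_pmf dim split: if_splits)
  also have "\<dots> = sum (pmf ?p) J" by (rule measure_measure_pmf_finite[OF fJ])
  also have "\<dots> = (\<Sum>\<sigma>\<in>J. ising_weight A \<beta> B \<sigma>) / ?Z"
    unfolding sum_divide_distrib
    by (intro sum.cong refl) (auto simp: pmf_ising_pmf dim J_def)
  also have "\<dots> \<le> exp (n * ?r)"
  proof (cases "J = {}")
    case False
    define ZJ where "ZJ = (\<Sum>\<sigma>\<in>J. ising_weight A \<beta> B \<sigma>)"
    have ZJ: "ZJ > 0" unfolding ZJ_def using fJ False
      by (intro sum_pos) (auto simp: ising_weight_def)
    \<comment> \<open>With \<open>l\<close> proportional to \<open>n\<close>, pinning costs at most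
      \<open>\<epsilon>\<close> per site, and the covariance error per site is a constant times
      \<open>frobenius_norm A / sqrt n\<close>.\<close>
    define l where "l = \<epsilon> * n"
    have l: "l > 0" using \<epsilon> n by (simp add: l_def)
    obtain m where m: "\<And>i. i < n \<Longrightarrow> \<bar>m i\<bar> \<le> 1" "(\<Sum>i<n. m i) / n \<in> C"
      and up: "ln ZJ \<le> mean_field A \<beta> B m + l * ln 2 + \<beta> / 2 * (frobenius_norm A * (n / sqrt l))"
      unfolding ZJ_def
      by (rule ln_sum_ising_weight_le[OF Ac n \<beta> l _ False C, of B]) (auto simp: J_def)
    have 1: "mean_field A \<beta> B m \<le> n * K" by (rule K[OF m])
    have "ln 2 \<le> (1 :: real)" using ln_le_minus_one[of 2] by simp
    then have 2: "l * ln 2 \<le> n * \<epsilon>" using l mult_left_mono[of "ln 2" 1 l] by (simp add: l_def mult_ac)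
    have 3: "frobenius_norm A * (n / sqrt l) = n * (frobenius_norm A / sqrt n / sqrt \<epsilon>)"
      by (simp add: l_def real_sqrt_mult mult_ac)
    define S where "S = (\<Sum>i<n. row_sum A i) / n"
    have "(\<Sum>i<n. \<Sum>j<n. A $$ (i, j) * (t * t)) = n * S * t\<^sup>2"
      using n Ac by (simp add: S_def row_sum_def sum_distrib_right[symmetric] power2_eq_square)
    then have mf: "mean_field A \<beta> B (\<lambda>_. t) = n * free_energy \<beta> B t + n * (\<beta> / 2 * ((S - 1) * t\<^sup>2))"
      by (simp add: mean_field_def free_energy_def dim algebra_simps)
    have "- \<bar>S - 1\<bar> \<le> (S - 1) * t\<^sup>2"
    proof -
      have "\<bar>(S - 1) * t\<^sup>2\<bar> \<le> \<bar>S - 1\<bar> * 1" unfolding abs_mult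
        using t by (intro mult_left_mono) (auto simp: abs_square_le_1)
      then show ?thesis by (metis abs_ge_minus_self minus_le_iff mult.right_neutral order_trans)
    qed
    then have "n * (\<beta> / 2 * (- \<bar>S - 1\<bar>)) \<le> n * (\<beta> / 2 * ((S - 1) * t\<^sup>2))"
      using \<beta> by (intro mult_left_mono) auto
    then have 4: "n * free_energy \<beta> B t - n * (\<beta> / 2 * \<bar>S - 1\<bar>) \<le> ln ?Z"
      using ln_ising_Z_ge[OF A t, of \<beta> B] unfolding mf by simp
    have "ln (ZJ / ?Z) = ln ZJ - ln ?Z" using ZJ Z by (rule ln_divide_pos)
    also have "\<dots> \<le> n * ?r"
      using up 1 2 4 unfolding 3 S_def[symmetric] by (simp add: algebra_simps)
    finally have "exp (ln (ZJ / ?Z)) \<le> exp (n * ?r)" by (subst exp_le_cancel_iff)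
    moreover have "ZJ / ?Z > 0" using ZJ Z by simp
    ultimately show ?thesis by (simp only: exp_ln ZJ_def)
  qed simp
  finally show ?thesis .
qed

section \<open>From bounds at fixed size to exponential rates\<close>

lemma limsup_elog_neg:
  assumes c: "c > 0" and ev: "eventually (\<lambda>N. p N \<le> K * exp (- (real N * c))) sequentially"
  shows "limsup (\<lambda>N. ereal (1 / real N) * elog (p N)) < 0"
proof -
  \<comment> \<open>The maximum with 1 keeps \<open>ln L\<close> meaningful for every
    \<open>K\<close>; the prefactor disappears after division by \<open>N\<close>, at the price of
    half the rate.\<close>
  define L where "L = max K 1"
  have "(\<lambda>N. ln L / real N) \<longlonglongrightarrow> 0" by real_asymp
  then have "eventually (\<lambda>N. ln L / real N < c / 2) sequentially"
    using c by (intro order_tendstoD) auto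
  then have "eventually (\<lambda>N. ereal (1 / real N) * elog (p N) \<le> ereal (- (c / 2))) sequentially"
    using ev eventually_gt_at_top[of 0]
  proof eventually_elim
    case (elim N)
    show ?case
    proof (cases "p N \<le> 0")
      case True
      then show ?thesis using elim by (simp add: elog_def)
    next
      case False
      have "p N \<le> L * exp (- (real N * c))"
        using elim(2) by (rule order_trans) (auto simp: L_def)
      then have "ln (p N) \<le> ln (L * exp (- (real N * c)))" using False by simp
      also have "\<dots> = ln L - real N * c" by (simp add: ln_mult L_def)
      finally have "1 / real N * ln (p N) \<le> 1 / real N * (ln L - real N * c)"
        by (intro mult_left_mono) auto
      also have "\<dots> = ln L / real N - c" using elim(3) by (simp add: field_simps)
      also have "\<dots> \<le> - (c / 2)" using elim(1) by linarith
      finally show ?thesis using False by (simp add: elog_def)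
    qed
  qed
  then have "limsup (\<lambda>N. ereal (1 / real N) * elog (p N)) \<le> ereal (- (c / 2))"
    by (rule Limsup_bounded)
  also have "\<dots> < 0" using c by simp
  finally show ?thesis .
qed

lemma limsup_prob_neg:
  fixes A :: "nat \<Rightarrow> real mat" and \<C> :: "real set set"
  assumes coupling: "\<And>N. 2 \<le> N \<Longrightarrow> coupling_matrix N (A N)"
    and S: "(\<lambda>N. (\<Sum>i<N. row_sum (A N) i) / real N) \<longlonglongrightarrow> 1"
    and F: "(\<lambda>N. frobenius_norm (A N) / sqrt (real N)) \<longlonglongrightarrow> 0"
    and \<beta>: "\<beta> \<ge> 0" and t: "\<bar>t\<bar> < 1" and c: "c > 0"
    and \<C>: "finite \<C>" "\<And>C. C \<in> \<C> \<Longrightarrow> convex C"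
    and K: "eventually (\<lambda>N. \<forall>m. (\<forall>i<N. \<bar>m i\<bar> \<le> 1) \<longrightarrow> (\<Sum>i<N. m i) / real N \<in> \<Union>\<C> \<longrightarrow>
        mean_field (A N) \<beta> B m \<le> N * (free_energy \<beta> B t - c)) sequentially"
    and P: "\<And>\<sigma>. P \<sigma> \<Longrightarrow> spin_mean \<sigma> \<in> \<Union>\<C>"
  shows "limsup (\<lambda>N. ereal (1 / real N) *
    elog (measure_pmf.prob (ising_pmf (A N) \<beta> B) {\<sigma>. P \<sigma>})) < 0"
proof (rule limsup_elog_neg)
  show "c / 2 > 0" using c by simp
  \<comment> \<open>The slack in the probability bound is taken as \<open>c / 4\<close>, so
    \<open>r\<close> tends to \<open>- 3 * c / 4\<close> and eventually lies below
    \<open>- c / 2\<close>.\<close>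
  define r where "r N = (free_energy \<beta> B t - c) - free_energy \<beta> B t + c / 4
      + \<beta> / 2 * (frobenius_norm (A N) / sqrt N / sqrt (c / 4))
      + \<beta> / 2 * \<bar>(\<Sum>i<N. row_sum (A N) i) / N - 1\<bar>" for N
  have "r \<longlonglongrightarrow> (free_energy \<beta> B t - c) - free_energy \<beta> B t + c / 4
      + \<beta> / 2 * (0 / sqrt (c / 4)) + \<beta> / 2 * \<bar>1 - 1\<bar>"
    unfolding r_def[abs_def] using c by (intro tendsto_intros S F) auto
  then have "eventually (\<lambda>N. r N < - (c / 2)) sequentially"
    by (rule order_tendstoD) (use c in simp)
  then show "eventually (\<lambda>N. measure_pmf.prob (ising_pmf (A N) \<beta> B) {\<sigma>. P \<sigma>}
      \<le> real (card \<C>) * exp (- (real N * (c / 2)))) sequentially"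
    using K eventually_ge_at_top[of 2]
  proof eventually_elim
    case (elim N)
    let ?p = "ising_pmf (A N) \<beta> B"
    have "measure_pmf.prob ?p {\<sigma>. P \<sigma>} \<le> measure_pmf.prob ?p (\<Union>C\<in>\<C>. {\<sigma>. spin_mean \<sigma> \<in> C})"
      by (rule measure_pmf.finite_measure_mono) (use P in auto)
    also have "\<dots> \<le> (\<Sum>C\<in>\<C>. measure_pmf.prob ?p {\<sigma>. spin_mean \<sigma> \<in> C})"
      by (rule measure_UNION_le[OF \<C>(1)]) simp
    also have "\<dots> \<le> (\<Sum>C\<in>\<C>. exp (- (real N * (c / 2))))"
    proof (rule sum_mono)
      fix C assume C: "C \<in> \<C>"
      have "measure_pmf.prob ?p {\<sigma>. spin_mean \<sigma> \<in> C} \<le> exp (N * r N)"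
        unfolding r_def
        by (rule prob_spin_mean_le[OF coupling _ \<beta> t _ \<C>(2)[OF C]]) (use elim(2,3) c C in auto)
      also have "\<dots> \<le> exp (- (real N * (c / 2)))"
        using mult_left_mono[of "r N" "- (c / 2)" N] elim(1) by simp
      finally show "measure_pmf.prob ?p {\<sigma>. spin_mean \<sigma> \<in> C} \<le> exp (- (real N * (c / 2)))" .
    qed
    finally show ?case by simp
  qed
qed

text \<open>The loss \<open>\<bar>x - t\<bar>\<close> is convex, so its sum over the sites is at
  least \<open>N\<close> times the distance of the average from \<open>t\<close>.\<close>

lemma mean_field_away_from_unique_max:
  fixes A :: "nat \<Rightarrow> real mat"
  assumes coupling: "\<And>N. 2 \<le> N \<Longrightarrow> coupling_matrix N (A N)"
    and top: "(\<lambda>N. kth_eigenvalue 1 (A N)) \<longlonglongrightarrow> 1"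
    and \<beta>: "\<beta> \<ge> 0" and t: "\<bar>t\<bar> < 1" and \<delta>: "\<delta> > 0"
    and max: "\<And>x. x \<in> {-1..1} \<Longrightarrow> x \<noteq> t \<Longrightarrow> free_energy \<beta> B x < free_energy \<beta> B t"
  obtains c where "c > 0"
    "eventually (\<lambda>N. \<forall>m. (\<forall>i<N. \<bar>m i\<bar> \<le> 1) \<longrightarrow> \<delta> \<le> \<bar>(\<Sum>i<N. m i) / real N - t\<bar> \<longrightarrow>
        mean_field (A N) \<beta> B m \<le> N * (free_energy \<beta> B t - c)) sequentially"
proof -
  obtain \<kappa> where \<kappa>: "0 < \<kappa>" "\<And>x. x \<in> {-1..1} \<Longrightarrow>
      free_energy \<beta> B x \<le> free_energy \<beta> B t - \<kappa> * \<bar>x - t\<bar> + \<kappa> * (\<delta> / 2)"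
  proof (rule linear_loss_away_from_max[of "{-1..1}" "free_energy \<beta> B" "\<lambda>x. \<bar>x - t\<bar>"
        "free_energy \<beta> B t" "\<delta> / 2" 1])
    show "continuous_on {-1..1} (free_energy \<beta> B)" by (rule continuous_on_free_energy)
    show "continuous_on {-1..1} (\<lambda>x. \<bar>x - t\<bar>)" by (intro continuous_intros)
    fix x :: real assume x: "x \<in> {-1..1}"
    show "free_energy \<beta> B x \<le> free_energy \<beta> B t" using max[OF x] by (cases "x = t") auto
    show "free_energy \<beta> B x < free_energy \<beta> B t" if "0 < \<bar>x - t\<bar>" using max[OF x] that by auto
    show "\<bar>x - t\<bar> \<le> 2" using x t by auto
  qed (use \<delta> in auto)
  \<comment> \<open>The loss \<open>\<kappa> * \<delta>\<close> minus the slack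
    \<open>\<kappa> * \<delta> / 2\<close> leaves \<open>2 * c\<close> per site; one
    \<open>c\<close> pays for the deviation of the top eigenvalue from 1.\<close>
  define c where "c = \<kappa> * \<delta> / 4"
  have c: "c > 0" using \<kappa> \<delta> by (simp add: c_def)
  have "(\<lambda>N. \<beta> / 2 * \<bar>kth_eigenvalue 1 (A N) - 1\<bar>) \<longlonglongrightarrow> \<beta> / 2 * \<bar>1 - 1\<bar>"
    by (intro tendsto_intros top)
  then have "eventually (\<lambda>N. \<beta> / 2 * \<bar>kth_eigenvalue 1 (A N) - 1\<bar> < c) sequentially"
    by (rule order_tendstoD) (use c in simp)
  then have "eventually (\<lambda>N. \<forall>m. (\<forall>i<N. \<bar>m i\<bar> \<le> 1) \<longrightarrow> \<delta> \<le> \<bar>(\<Sum>i<N. m i) / real N - t\<bar> \<longrightarrow>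
        mean_field (A N) \<beta> B m \<le> N * (free_energy \<beta> B t - c)) sequentially"
    using eventually_ge_at_top[of 2]
  proof eventually_elim
    case (elim N)
    show ?case
    proof (intro allI impI)
      fix m :: "nat \<Rightarrow> real"
      assume m: "\<forall>i<N. \<bar>m i\<bar> \<le> 1" and far: "\<delta> \<le> \<bar>(\<Sum>i<N. m i) / real N - t\<bar>"
      have N: "real N > 0" using elim by simp
      have "N * \<delta> \<le> N * \<bar>(\<Sum>i<N. m i) / real N - t\<bar>" using far N by (intro mult_left_mono) auto
      also have "\<dots> = \<bar>N * ((\<Sum>i<N. m i) / real N - t)\<bar>" by (simp add: abs_mult)
      also have "N * ((\<Sum>i<N. m i) / real N - t) = (\<Sum>i<N. m i - t)"
        using N by (simp add: sum_subtractf right_diff_distrib)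
      also have "\<bar>\<dots>\<bar> \<le> (\<Sum>i<N. \<bar>m i - t\<bar>)" by (rule sum_abs)
      finally have far': "\<kappa> * (N * \<delta>) \<le> \<kappa> * (\<Sum>i<N. \<bar>m i - t\<bar>)"
        using \<kappa>(1) by (intro mult_left_mono) auto
      have "(\<Sum>i<N. free_energy \<beta> B (m i))
          \<le> (\<Sum>i<N. free_energy \<beta> B t - \<kappa> * \<bar>m i - t\<bar> + \<kappa> * (\<delta> / 2))"
        using m by (intro sum_mono \<kappa>(2)) (auto simp: abs_le_iff)
      also have "\<dots> = N * free_energy \<beta> B t - \<kappa> * (\<Sum>i<N. \<bar>m i - t\<bar>) + N * (\<kappa> * (\<delta> / 2))"
        by (simp add: sum.distrib sum_subtractf sum_distrib_left)
      also have "\<dots> \<le> N * free_energy \<beta> B t - \<kappa> * (N * \<delta>) + N * (\<kappa> * (\<delta> / 2))" using far' by linarith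
      also have "\<dots> = N * (free_energy \<beta> B t - 2 * c)" by (simp add: c_def algebra_simps)
      finally have "(\<Sum>i<N. free_energy \<beta> B (m i)) \<le> N * (free_energy \<beta> B t - 2 * c)" .
      moreover have "N * (\<beta> / 2 * \<bar>kth_eigenvalue 1 (A N) - 1\<bar>) \<le> N * c"
        using elim(1) by (intro mult_left_mono) auto
      ultimately show "mean_field (A N) \<beta> B m \<le> N * (free_energy \<beta> B t - c)"
        using mean_field_le[OF coupling[OF elim(2)] \<beta>, of m B] m by (simp add: algebra_simps)
    qed
  qed
  then show thesis using that c by blast
qed

text \<open>The loss \<open>\<bar>x\<^sup>2 - t\<^sup>2\<bar>\<close> controls only the sum
  \<open>V\<close> of the squares, which cannot tell a pure phase from a mixture of both. The
  difference from \<open>V\<close> to \<open>W\<close>, \<open>N\<close> times the squared average,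
  is \<open>N\<close> times the variance, and the spectral gap charges for it.\<close>

lemma mean_field_away_from_double_well:
  fixes A :: "nat \<Rightarrow> real mat"
  assumes coupling: "\<And>N. 2 \<le> N \<Longrightarrow> coupling_matrix N (A N)"
    and top: "(\<lambda>N. kth_eigenvalue 1 (A N)) \<longlonglongrightarrow> 1"
    and S: "(\<lambda>N. (\<Sum>i<N. row_sum (A N) i) / real N) \<longlonglongrightarrow> 1"
    and gap: "limsup (\<lambda>N. ereal (kth_eigenvalue 2 (A N) / kth_eigenvalue 1 (A N))) < 1"
    and \<beta>: "\<beta> > 0" and t: "\<bar>t\<bar> < 1" and a: "a > 0"
    and max: "\<And>x. x \<in> {-1..1} \<Longrightarrow> free_energy \<beta> 0 x \<le> free_energy \<beta> 0 t"
      "\<And>x. x \<in> {-1..1} \<Longrightarrow> x\<^sup>2 \<noteq> t\<^sup>2 \<Longrightarrow> free_energy \<beta> 0 x < free_energy \<beta> 0 t"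
  obtains c where "c > 0"
    "eventually (\<lambda>N. \<forall>m. (\<forall>i<N. \<bar>m i\<bar> \<le> 1) \<longrightarrow> a \<le> \<bar>((\<Sum>i<N. m i) / real N)\<^sup>2 - t\<^sup>2\<bar> \<longrightarrow>
        mean_field (A N) \<beta> 0 m \<le> N * (free_energy \<beta> 0 t - c)) sequentially"
proof -
  obtain r0 where r0: "limsup (\<lambda>N. ereal (kth_eigenvalue 2 (A N) / kth_eigenvalue 1 (A N))) < ereal r0"
    "ereal r0 < 1" using ereal_dense2[OF gap] by blast
  define r where "r = max 0 r0"
  have r: "0 \<le> r" "r < 1" "r0 \<le> r" using r0(2) by (auto simp: r_def)
  \<comment> \<open>The strength of the variance penalty: the gap bound with
    \<open>\<mu> = r * L\<close> gives \<open>\<beta> / 2 * ((1 - r) * L)\<close>, and eventually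
    \<open>L > 1 / 2\<close>. Keeping \<open>\<kappa> \<le> \<kappa>0\<close> allows the same
    \<open>\<kappa>\<close> for both penalties.\<close>
  define \<kappa>0 where "\<kappa>0 = \<beta> / 2 * ((1 - r) / 2)"
  have \<kappa>0: "\<kappa>0 > 0" using \<beta> r by (simp add: \<kappa>0_def)
  obtain \<kappa> where \<kappa>: "0 < \<kappa>" "\<kappa> \<le> \<kappa>0" "\<And>x. x \<in> {-1..1} \<Longrightarrow>
      free_energy \<beta> 0 x \<le> free_energy \<beta> 0 t - \<kappa> * \<bar>x\<^sup>2 - t\<^sup>2\<bar> + \<kappa> * (a / 2)"
  proof (rule linear_loss_away_from_max[of "{-1..1}" "free_energy \<beta> 0" "\<lambda>x. \<bar>x\<^sup>2 - t\<^sup>2\<bar>"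
        "free_energy \<beta> 0 t" "a / 2" \<kappa>0])
    show "continuous_on {-1..1} (free_energy \<beta> 0)" by (rule continuous_on_free_energy)
    show "continuous_on {-1..1} (\<lambda>x. \<bar>x\<^sup>2 - t\<^sup>2\<bar>)" by (intro continuous_intros)
    fix x :: real assume x: "x \<in> {-1..1}"
    show "free_energy \<beta> 0 x \<le> free_energy \<beta> 0 t" by (rule max(1)[OF x])
    show "free_energy \<beta> 0 x < free_energy \<beta> 0 t" if "0 < \<bar>x\<^sup>2 - t\<^sup>2\<bar>"
      using max(2)[OF x] that by auto
    have "x\<^sup>2 \<le> 1" "t\<^sup>2 \<le> 1" using x t by (auto simp: abs_square_le_1 abs_le_iff)
    then show "\<bar>x\<^sup>2 - t\<^sup>2\<bar> \<le> 2"
      using zero_le_power2[of x] zero_le_power2[of t] by linarith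
  qed (use a \<kappa>0 in auto)
  define c where "c = \<kappa> * a / 4"
  have c: "c > 0" using \<kappa> a by (simp add: c_def)
  \<comment> \<open>The error of \<open>quadratic_form_le_mean\<close> per site for
    \<open>\<mu> = r * L\<close>; it vanishes because the top eigenvalue and the average row sum
    have the same limit.\<close>
  define s where "s N = 3 * sqrt ((kth_eigenvalue 1 (A N) - r * kth_eigenvalue 1 (A N))
      * (kth_eigenvalue 1 (A N) - (\<Sum>i<N. row_sum (A N) i) / real N))" for N
  have "(\<lambda>N. \<beta> / 2 * (\<bar>kth_eigenvalue 1 (A N) - 1\<bar> + s N))
      \<longlonglongrightarrow> \<beta> / 2 * (\<bar>1 - 1\<bar> + 3 * sqrt ((1 - r * 1) * (1 - 1)))"
    unfolding s_def by (intro tendsto_intros top S)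
  then have "eventually (\<lambda>N. \<beta> / 2 * (\<bar>kth_eigenvalue 1 (A N) - 1\<bar> + s N) < c) sequentially"
    by (rule order_tendstoD) (use c in simp)
  moreover have "eventually (\<lambda>N. 1 / 2 < kth_eigenvalue 1 (A N)) sequentially"
    by (rule order_tendstoD(1)[OF top]) simp
  moreover note Limsup_lessD[OF r0(1)]
  ultimately have "eventually (\<lambda>N. \<forall>m. (\<forall>i<N. \<bar>m i\<bar> \<le> 1) \<longrightarrow>
      a \<le> \<bar>((\<Sum>i<N. m i) / real N)\<^sup>2 - t\<^sup>2\<bar> \<longrightarrow>
        mean_field (A N) \<beta> 0 m \<le> N * (free_energy \<beta> 0 t - c)) sequentially"
    using eventually_ge_at_top[of 2]
  proof eventually_elim
    case (elim N)
    define L where "L = kth_eigenvalue 1 (A N)"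
    have L: "1 / 2 < L" using elim(2) by (simp add: L_def)
    have \<mu>: "kth_eigenvalue 2 (A N) \<le> r * L" "r * L \<le> L"
    proof -
      have "kth_eigenvalue 2 (A N) / L \<le> r" using elim(3) r by (simp add: L_def)
      then show "kth_eigenvalue 2 (A N) \<le> r * L" using L by (simp add: field_simps)
      show "r * L \<le> L" using r L by simp
    qed
    have N: "N > 0" using elim by simp
    show ?case
    proof (intro allI impI)
      fix m :: "nat \<Rightarrow> real"
      assume m: "\<forall>i<N. \<bar>m i\<bar> \<le> 1" and far: "a \<le> \<bar>((\<Sum>i<N. m i) / real N)\<^sup>2 - t\<^sup>2\<bar>"
      define V where "V = (\<Sum>i<N. (m i)\<^sup>2)"
      define W where "W = N * ((\<Sum>i<N. m i) / real N)\<^sup>2"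
      define Q where "Q = (\<Sum>i<N. \<Sum>j<N. A N $$ (i, j) * (m i * m j))"
      have VN: "V \<le> N" unfolding V_def using m by (intro sum_squares_le_card) auto
      have V0: "V \<ge> 0" unfolding V_def by (intro sum_nonneg) auto
      have WV: "W \<le> V"
      proof -
        have "(\<Sum>i<N. m i * 1)\<^sup>2 \<le> (\<Sum>i<N. (m i)\<^sup>2) * (\<Sum>i<N. 1\<^sup>2)" by (rule Cauchy_Schwarz_ineq_sum)
        then show ?thesis using N by (simp add: W_def V_def power_divide power2_eq_square field_simps)
      qed
      have "Q \<le> r * L * V + (L - r * L) * W + N * s N"
        using quadratic_form_le_mean[OF coupling[OF elim(4)] N _ \<mu>[unfolded L_def], of m] m
        unfolding Q_def V_def W_def L_def s_def by simp
      then have "Q - V \<le> (L - 1) * V - (1 - r) * L * (V - W) + N * s N" by (simp add: algebra_simps)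
      moreover have "(L - 1) * V \<le> \<bar>L - 1\<bar> * N" using VN V0 by (intro mult_mono) auto
      moreover have "(1 - r) / 2 * (V - W) \<le> (1 - r) * L * (V - W)"
        using r L WV by (intro mult_right_mono) auto
      ultimately have "Q - V \<le> N * (\<bar>L - 1\<bar> + s N) - (1 - r) / 2 * (V - W)"
        by (simp add: algebra_simps)
      then have "\<beta> / 2 * (Q - V) \<le> \<beta> / 2 * (N * (\<bar>L - 1\<bar> + s N) - (1 - r) / 2 * (V - W))"
        using \<beta> by (intro mult_left_mono) auto
      also have "\<dots> = N * (\<beta> / 2 * (\<bar>L - 1\<bar> + s N)) - \<kappa>0 * (V - W)"
        by (simp add: \<kappa>0_def field_simps)
      also have "\<dots> \<le> N * c - \<kappa> * (V - W)"
        using elim(1) \<kappa>(2) WV by (intro diff_mono mult_left_mono mult_right_mono) (auto simp: L_def)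
      finally have 1: "\<beta> / 2 * (Q - V) \<le> N * c - \<kappa> * (V - W)" .
      have "\<bar>V - N * t\<^sup>2\<bar> \<le> (\<Sum>i<N. \<bar>(m i)\<^sup>2 - t\<^sup>2\<bar>)"
        using sum_abs[of "\<lambda>i. (m i)\<^sup>2 - t\<^sup>2" "{..<N}"] by (simp add: V_def sum_subtractf)
      moreover have "N * a \<le> \<bar>W - N * t\<^sup>2\<bar>"
      proof -
        have "N * a \<le> N * \<bar>((\<Sum>i<N. m i) / real N)\<^sup>2 - t\<^sup>2\<bar>" using far by (intro mult_left_mono) auto
        also have "\<dots> = \<bar>N * (((\<Sum>i<N. m i) / real N)\<^sup>2 - t\<^sup>2)\<bar>" by (simp add: abs_mult)
        finally show ?thesis by (simp add: W_def right_diff_distrib)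
      qed
      \<comment> \<open>A deviation of \<open>W\<close> from \<open>N * t\<^sup>2\<close> comes
        either from \<open>V\<close> or from the variance \<open>V - W\<close>, and each is
        penalized at rate at least \<open>\<kappa>\<close>.\<close>
      ultimately have "N * a \<le> (\<Sum>i<N. \<bar>(m i)\<^sup>2 - t\<^sup>2\<bar>) + (V - W)" using WV by linarith
      then have 2: "\<kappa> * (N * a) \<le> \<kappa> * (\<Sum>i<N. \<bar>(m i)\<^sup>2 - t\<^sup>2\<bar>) + \<kappa> * (V - W)"
        using \<kappa>(1) by (metis distrib_left less_eq_real_def mult_left_mono)
      have "(\<Sum>i<N. free_energy \<beta> 0 (m i))
          \<le> (\<Sum>i<N. free_energy \<beta> 0 t - \<kappa> * \<bar>(m i)\<^sup>2 - t\<^sup>2\<bar> + \<kappa> * (a / 2))"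
        using m by (intro sum_mono \<kappa>(3)) (auto simp: abs_le_iff)
      also have "\<dots> = N * free_energy \<beta> 0 t - \<kappa> * (\<Sum>i<N. \<bar>(m i)\<^sup>2 - t\<^sup>2\<bar>) + N * (\<kappa> * (a / 2))"
        by (simp add: sum.distrib sum_subtractf sum_distrib_left)
      finally have 3: "(\<Sum>i<N. free_energy \<beta> 0 (m i))
          \<le> N * free_energy \<beta> 0 t - \<kappa> * (\<Sum>i<N. \<bar>(m i)\<^sup>2 - t\<^sup>2\<bar>) + N * (\<kappa> * (a / 2))" .
      have "A N \<in> carrier_mat N N" using coupling[OF elim(4)] by (simp add: coupling_matrix_def)
      then have "mean_field (A N) \<beta> 0 m = (\<Sum>i<N. free_energy \<beta> 0 (m i)) + \<beta> / 2 * (Q - V)"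
        unfolding Q_def V_def by (rule mean_field_split)
      also have "\<dots> \<le> N * free_energy \<beta> 0 t - \<kappa> * (N * a) + N * (\<kappa> * (a / 2)) + N * c"
        using 1 2 3 by linarith
      also have "\<dots> = N * (free_energy \<beta> 0 t - c)" by (simp add: c_def algebra_simps)
      finally show "mean_field (A N) \<beta> 0 m \<le> N * (free_energy \<beta> 0 t - c)" .
    qed
  qed
  then show thesis using that c by blast
qed

text \<open>By Cauchy-Schwarz the squared deviation of the average from 1 is at most the average
  squared deviation.\<close>

lemma average_row_sum_tendsto_one:
  fixes R :: "nat \<Rightarrow> nat \<Rightarrow> real"
  assumes "(\<lambda>N. 1 / real N * (\<Sum>i<N. (R N i - 1)\<^sup>2)) \<longlonglongrightarrow> 0"
  shows "(\<lambda>N. (\<Sum>i<N. R N i) / real N) \<longlonglongrightarrow> 1"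
proof -
  have "(\<lambda>N. (\<Sum>i<N. R N i) / real N - 1) \<longlonglongrightarrow> 0"
  proof (rule Lim_null_comparison)
    show "(\<lambda>N. sqrt (1 / real N * (\<Sum>i<N. (R N i - 1)\<^sup>2))) \<longlonglongrightarrow> 0"
      using tendsto_real_sqrt[OF assms] by simp
    show "eventually (\<lambda>N. norm ((\<Sum>i<N. R N i) / real N - 1)
        \<le> sqrt (1 / real N * (\<Sum>i<N. (R N i - 1)\<^sup>2))) sequentially"
      using eventually_gt_at_top[of 0]
    proof eventually_elim
      case (elim N)
      have "(\<Sum>i<N. R N i) / real N - 1 = (\<Sum>i<N. R N i - 1) / N"
        using elim by (simp add: sum_subtractf field_simps)
      moreover have "(\<Sum>i<N. (R N i - 1) * 1)\<^sup>2 \<le> (\<Sum>i<N. (R N i - 1)\<^sup>2) * (\<Sum>i<N. 1\<^sup>2)"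
        by (rule Cauchy_Schwarz_ineq_sum)
      ultimately have "((\<Sum>i<N. R N i) / real N - 1)\<^sup>2 \<le> 1 / real N * (\<Sum>i<N. (R N i - 1)\<^sup>2)"
        using elim by (simp add: power_divide power2_eq_square field_simps)
      then show ?case by (metis real_norm_def real_sqrt_abs real_sqrt_le_iff)
    qed
  qed
  then show ?thesis using Lim_null by blast
qed

theorem corollary1p1:
  fixes A :: "nat \<Rightarrow> real mat" and \<beta> B :: real
  assumes coupling: "\<And>N. 2 \<le> N \<Longrightarrow> coupling_matrix N (A N)"
    and row_bound: "bdd_above ((\<lambda>N. Max (row_sum (A N) ` {..<N})) ` {2..})"
    and top_eig: "(\<lambda>N. kth_eigenvalue 1 (A N)) \<longlonglongrightarrow> 1"
    and row_avg: "(\<lambda>N. 1 / real N * (\<Sum>i<N. (row_sum (A N) i - 1)\<^sup>2)) \<longlonglongrightarrow> 0"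
    and frob: "(\<lambda>N. 1 / real N * (frobenius_norm (A N))\<^sup>2) \<longlonglongrightarrow> 0"
  shows "((\<beta>, B) \<in> Theta1 \<longrightarrow>
           (\<forall>\<delta>>0. limsup (\<lambda>N. ereal (1 / real N) *
              elog (measure_pmf.prob (ising_pmf (A N) \<beta> B)
                {\<sigma>. \<bar>spin_mean \<sigma> - magnetization \<beta> B\<bar> > \<delta>})) < 0)) \<and>
         ((\<beta>, B) \<in> Theta3 \<and>
          limsup (\<lambda>N. ereal (kth_eigenvalue 2 (A N) / kth_eigenvalue 1 (A N))) < 1 \<longrightarrow>
           (\<forall>\<delta>>0. limsup (\<lambda>N. ereal (1 / real N) *
              elog (measure_pmf.prob (ising_pmf (A N) \<beta> B)
                {\<sigma>. \<bar>spin_mean \<sigma> - magnetization \<beta> B\<bar> > \<delta>})) < 0)) \<and>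
         ((\<beta>, B) \<in> Theta2 \<and>
          limsup (\<lambda>N. ereal (kth_eigenvalue 2 (A N) / kth_eigenvalue 1 (A N))) < 1 \<longrightarrow>
           (\<forall>\<delta>>0. limsup (\<lambda>N. ereal (1 / real N) *
              elog (measure_pmf.prob (ising_pmf (A N) \<beta> B)
                {\<sigma>. \<bar>spin_mean \<sigma> - signed_magnetization \<beta> B \<sigma>\<bar> > \<delta>})) < 0))"
proof -
  have S: "(\<lambda>N. (\<Sum>i<N. row_sum (A N) i) / real N) \<longlonglongrightarrow> 1"
    by (rule average_row_sum_tendsto_one[OF row_avg])
  have "frobenius_norm M \<ge> 0" for M
    by (auto simp: frobenius_norm_def intro!: sum_nonneg)
  then have "sqrt (1 / real N * (frobenius_norm (A N))\<^sup>2) = frobenius_norm (A N) / sqrt N" for N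
    by (simp add: real_sqrt_mult real_sqrt_divide)
  then have F: "(\<lambda>N. frobenius_norm (A N) / sqrt (real N)) \<longlonglongrightarrow> 0"
    using tendsto_real_sqrt[OF frob] by simp
  define t where "t = magnetization \<beta> B"
  have unique: "limsup (\<lambda>N. ereal (1 / real N) * elog (measure_pmf.prob (ising_pmf (A N) \<beta> B)
      {\<sigma>. \<bar>spin_mean \<sigma> - t\<bar> > \<delta>})) < 0" if \<Theta>: "(\<beta>, B) \<in> Theta1 \<union> Theta3" and \<delta>: "\<delta> > 0" for \<delta>
  proof -
    have \<beta>: "\<beta> \<ge> 0" using \<Theta> by (auto simp: Theta1_def Theta11_def Theta12_def Theta3_def)
    have t: "\<bar>t\<bar> < 1" and max: "\<And>x. x \<in> {-1..1} \<Longrightarrow> x \<noteq> t \<Longrightarrow> free_energy \<beta> B x < free_energy \<beta> B t"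
      using magnetization_unique_max[OF \<Theta>] by (auto simp: t_def)
    obtain c where c: "c > 0" and ev:
      "eventually (\<lambda>N. \<forall>m. (\<forall>i<N. \<bar>m i\<bar> \<le> 1) \<longrightarrow> \<delta> \<le> \<bar>(\<Sum>i<N. m i) / real N - t\<bar> \<longrightarrow>
        mean_field (A N) \<beta> B m \<le> N * (free_energy \<beta> B t - c)) sequentially"
      by (rule mean_field_away_from_unique_max[OF coupling top_eig \<beta> t \<delta> max])
    show ?thesis
    proof (rule limsup_prob_neg[OF coupling S F \<beta> t c, of "{{t + \<delta><..}, {..<t - \<delta>}}"])
      show "eventually (\<lambda>N. \<forall>m. (\<forall>i<N. \<bar>m i\<bar> \<le> 1) \<longrightarrow>
          (\<Sum>i<N. m i) / real N \<in> \<Union>{{t + \<delta><..}, {..<t - \<delta>}} \<longrightarrow>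
          mean_field (A N) \<beta> B m \<le> N * (free_energy \<beta> B t - c)) sequentially"
        using ev by (rule eventually_mono) (auto simp: abs_if)
    qed (auto simp: abs_if split: if_splits)
  qed
  have double: "limsup (\<lambda>N. ereal (1 / real N) * elog (measure_pmf.prob (ising_pmf (A N) \<beta> B)
      {\<sigma>. \<bar>spin_mean \<sigma> - signed_magnetization \<beta> B \<sigma>\<bar> > \<delta>})) < 0"
    if \<Theta>: "(\<beta>, B) \<in> Theta2" and \<delta>: "\<delta> > 0"
      and gap: "limsup (\<lambda>N. ereal (kth_eigenvalue 2 (A N) / kth_eigenvalue 1 (A N))) < 1" for \<delta>
  proof -
    have \<beta>1: "\<beta> > 1" and B: "B = 0" using \<Theta> by (auto simp: Theta2_def)
    then have \<beta>: "\<beta> > 0" by simp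
    note well = magnetization_double_well[OF \<beta>1]
    have t: "0 < t" "t < 1" using well B by (auto simp: t_def)
    then have t': "\<bar>t\<bar> < 1" by simp
    have even: "free_energy \<beta> 0 \<bar>x\<bar> = free_energy \<beta> 0 x" for x
      by (cases "x \<ge> 0") (auto simp: free_energy_minus)
    have max: "free_energy \<beta> 0 x < free_energy \<beta> 0 t" if "x \<in> {-1..1}" "x\<^sup>2 \<noteq> t\<^sup>2" for x
    proof -
      have "\<bar>x\<bar> \<noteq> t" using that(2) by auto
      then show ?thesis using well(3)[OF that(1)] B by (simp add: t_def)
    qed
    have max': "free_energy \<beta> 0 x \<le> free_energy \<beta> 0 t" if "x \<in> {-1..1}" for x
      using well(3)[OF that] even[of x] B by (cases "\<bar>x\<bar> = t") (auto simp: t_def)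
    \<comment> \<open>A distance \<open>\<delta>\<close> between \<open>\<bar>x\<bar>\<close> and
      \<open>t\<close> becomes \<open>\<delta> * t\<close> for the squares, since the other factor
      \<open>\<bar>x\<bar> + t\<close> is at least \<open>t\<close>.\<close>
    have a: "\<delta> * t > 0" using \<delta> t by simp
    obtain c where c: "c > 0" and ev:
      "eventually (\<lambda>N. \<forall>m. (\<forall>i<N. \<bar>m i\<bar> \<le> 1) \<longrightarrow> \<delta> * t \<le> \<bar>((\<Sum>i<N. m i) / real N)\<^sup>2 - t\<^sup>2\<bar> \<longrightarrow>
        mean_field (A N) \<beta> 0 m \<le> N * (free_energy \<beta> 0 t - c)) sequentially"
      by (rule mean_field_away_from_double_well[OF coupling top_eig S gap \<beta> t' a max' max])
    \<comment> \<open>The sign of the mean selects the phase, so the event is cut at 0 as well as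
      around the two phases. The point 0 goes to the nonnegative side as in
      \<open>signed_magnetization\<close>, and the inner intervals are empty when
      \<open>\<delta> \<ge> t\<close>.\<close>
    let ?C = "{{t + \<delta><..}, {0..<t - \<delta>}, {..<- t - \<delta>}, {- t + \<delta><..<0}}"
    have far: "\<delta> * t \<le> \<bar>x\<^sup>2 - t\<^sup>2\<bar>" if "x \<in> \<Union>?C" for x
    proof -
      have "\<delta> \<le> \<bar>\<bar>x\<bar> - t\<bar>" using that t \<delta> by auto
      then have "\<delta> * t \<le> \<bar>\<bar>x\<bar> - t\<bar> * (\<bar>x\<bar> + t)" using t \<delta> by (intro mult_mono) auto
      also have "\<dots> = \<bar>(\<bar>x\<bar> - t) * (\<bar>x\<bar> + t)\<bar>" using t by (simp add: abs_mult)
      also have "(\<bar>x\<bar> - t) * (\<bar>x\<bar> + t) = x\<^sup>2 - t\<^sup>2"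
        by (simp add: power2_eq_square algebra_simps flip: abs_mult)
      finally show ?thesis .
    qed
    show ?thesis unfolding B
    proof (rule limsup_prob_neg[OF coupling S F less_imp_le[OF \<beta>] t' c, of ?C])
      show "eventually (\<lambda>N. \<forall>m. (\<forall>i<N. \<bar>m i\<bar> \<le> 1) \<longrightarrow> (\<Sum>i<N. m i) / real N \<in> \<Union>?C \<longrightarrow>
          mean_field (A N) \<beta> 0 m \<le> N * (free_energy \<beta> 0 t - c)) sequentially"
        using ev by (rule eventually_mono) (use far in blast)
      show "spin_mean \<sigma> \<in> \<Union>?C" if "\<delta> < \<bar>spin_mean \<sigma> - signed_magnetization \<beta> 0 \<sigma>\<bar>" for \<sigma>
        using that t unfolding signed_magnetization_def t_def B
        by (auto simp: abs_if split: if_splits)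
    qed auto
  qed
  show ?thesis using unique double unfolding t_def by blast
qed

end
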